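(* Let $d\ge1$ be an integer and let $\mathcal{M}$ be a $d$-cluster tilting subcategory of an abelian length category $\mathcal{A}$. Let $f\colon M\to N$ be a morphism in $\mathcal{M}$. Then there exists a factorisation $f=f_2\circ f_1$ in $\mathcal{M}$ where $f_2$ is a monomorphism and $f_1$ is a composite of left minimal weak cokernels.
   Context: Conventions: $\mathcal{A}$ is an essentially small abelian category in which every object has finite length. All subcategories are full and closed under isomorphisms, finite direct sums and direct summands. A subcategory $\mathcal{X}\subseteq\mathcal{A}$ is generating (cogenerating) if every object of $\mathcal{A}$ is a quotient of (a subobject of) an object of $\mathcal{X}$. A left $\mathcal{X}$-approximation of $Y\in\mathcal{A}$ is a morphism $Y\to X$ with $X\in\mathcal{X}$ through which every morphism from $Y$ to an object of $\mathcal{X}$ factors; right $\mathcal{X}$-approximations are dual. $\mathcal{X}$ is functorially finite if every object of $\mathcal{A}$ admits a left and a right $\mathcal{X}$-approximation. A functorially finite generating-cogenerating subcategory $\mathcal{M}\subseteq\mathcal{A}$ is $d$-cluster tilting if $$\mathcal{M}=\{X\in\mathcal{A}\mid \operatorname{Ext}^i_{\mathcal{A}}(X,M)=0 \ \forall M\in\mathcal{M},\ 1\le i\le d-1\}=\{Y\in\mathcal{A}\mid \operatorname{Ext}^i_{\mathcal{A}}(M,Y)=0\ \forall M\in\mathcal{M},\ 1\le i\le d-1\}.$$ A morphism $f\colon X\to Y$ is left minimal if every endomorphism $g$ of $Y$ with $g\circ f=f$ is an isomorphism. A morphism $g\colon Y\to Z$ in $\mathcal{M}$ is a weak cokernel of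 $f\colon X\to Y$ in $\mathcal{M}$ if $\operatorname{Hom}(Z,M)\to\operatorname{Hom}(Y,M)\to\operatorname{Hom}(X,M)$ is exact for every $M\in\mathcal{M}$; $g$ is called a weak cokernel if it is a weak cokernel of some morphism $f$ in $\mathcal{M}$. *)

theory Defs
  imports "HOL-Algebra.Group"
begin

section \<open>Categories with additive structure on the morphisms\<close>

text \<open>A small category is a set of objects and a set of arrows with source and target; values of
  the operations outside of these sets (or on non-composable arrows) are irrelevant.\<close>

record ('o, 'm) cat_data =
  Obj :: "'o set"
  Arr :: "'m set"
  Dom :: "'m \<Rightarrow> 'o"
  Cod :: "'m \<Rightarrow> 'o"
  Ident :: "'o \<Rightarrow> 'm"
  Comp :: "'m \<Rightarrow> 'm \<Rightarrow> 'm"  (infixl "\<cdot>\<index>" 70)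
  Zero :: "'o \<Rightarrow> 'o \<Rightarrow> 'm"
  Add :: "'m \<Rightarrow> 'm \<Rightarrow> 'm"  (infixl "\<boxplus>\<index>" 65)

definition Mor :: "('o, 'm, 'z) cat_data_scheme \<Rightarrow> 'o \<Rightarrow> 'o \<Rightarrow> 'm set" where
  "Mor C X Y = {f \<in> Arr C. Dom C f = X \<and> Cod C f = Y}"

definition Mor_group :: "('o, 'm, 'z) cat_data_scheme \<Rightarrow> 'o \<Rightarrow> 'o \<Rightarrow> 'm monoid" where
  "Mor_group C X Y = \<lparr>carrier = Mor C X Y, mult = Add C, one = Zero C X Y\<rparr>"

locale small_category =
  fixes C :: "('o, 'm) cat_data" (structure)
  assumes Dom_Obj: "f \<in> Arr C \<Longrightarrow> Dom C f \<in> Obj C"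
    and Cod_Obj: "f \<in> Arr C \<Longrightarrow> Cod C f \<in> Obj C"
    and Ident_Mor: "X \<in> Obj C \<Longrightarrow> Ident C X \<in> Mor C X X"
    and Comp_Mor: "\<lbrakk>f \<in> Mor C X Y; g \<in> Mor C Y Z\<rbrakk> \<Longrightarrow> g \<cdot> f \<in> Mor C X Z"
    and Comp_Ident: "f \<in> Mor C X Y \<Longrightarrow> f \<cdot> Ident C X = f"
    and Ident_Comp: "f \<in> Mor C X Y \<Longrightarrow> Ident C Y \<cdot> f = f"
    and Comp_assoc: "\<lbrakk>f \<in> Mor C W X; g \<in> Mor C X Y; h \<in> Mor C Y Z\<rbrakk>
           \<Longrightarrow> h \<cdot> (g \<cdot> f) = (h \<cdot> g) \<cdot> f"

locale preadditive_category = small_category +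
  assumes Mor_comm_group: "\<lbrakk>X \<in> Obj C; Y \<in> Obj C\<rbrakk> \<Longrightarrow> comm_group (Mor_group C X Y)"
    and Comp_Add_right: "\<lbrakk>f \<in> Mor C X Y; f' \<in> Mor C X Y; g \<in> Mor C Y Z\<rbrakk>
           \<Longrightarrow> g \<cdot> (f \<boxplus> f') = (g \<cdot> f) \<boxplus> (g \<cdot> f')"
    and Comp_Add_left: "\<lbrakk>f \<in> Mor C X Y; g \<in> Mor C Y Z; g' \<in> Mor C Y Z\<rbrakk>
           \<Longrightarrow> (g \<boxplus> g') \<cdot> f = (g \<cdot> f) \<boxplus> (g' \<cdot> f)"

definition monic :: "('o, 'm, 'z) cat_data_scheme \<Rightarrow> 'm \<Rightarrow> bool" where
  "monic C f \<longleftrightarrow> f \<in> Arr C \<and>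
     (\<forall>W \<in> Obj C. \<forall>g \<in> Mor C W (Dom C f). \<forall>h \<in> Mor C W (Dom C f).
        f \<cdot>\<^bsub>C\<^esub> g = f \<cdot>\<^bsub>C\<^esub> h \<longrightarrow> g = h)"

definition epic :: "('o, 'm, 'z) cat_data_scheme \<Rightarrow> 'm \<Rightarrow> bool" where
  "epic C f \<longleftrightarrow> f \<in> Arr C \<and>
     (\<forall>W \<in> Obj C. \<forall>g \<in> Mor C (Cod C f) W. \<forall>h \<in> Mor C (Cod C f) W.
        g \<cdot>\<^bsub>C\<^esub> f = h \<cdot>\<^bsub>C\<^esub> f \<longrightarrow> g = h)"

definition isomorphism :: "('o, 'm, 'z) cat_data_scheme \<Rightarrow> 'm \<Rightarrow> bool" where
  "isomorphism C f \<longleftrightarrow> f \<in> Arr C \<and>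
     (\<exists>g \<in> Mor C (Cod C f) (Dom C f).
        g \<cdot>\<^bsub>C\<^esub> f = Ident C (Dom C f) \<and> f \<cdot>\<^bsub>C\<^esub> g = Ident C (Cod C f))"

definition zero_object :: "('o, 'm, 'z) cat_data_scheme \<Rightarrow> 'o \<Rightarrow> bool" where
  "zero_object C Z \<longleftrightarrow> Z \<in> Obj C \<and>
     (\<forall>X \<in> Obj C. (\<exists>!f. f \<in> Mor C Z X) \<and> (\<exists>!f. f \<in> Mor C X Z))"

definition direct_sum ::
  "('o, 'm, 'z) cat_data_scheme \<Rightarrow> 'o \<Rightarrow> 'o \<Rightarrow> 'o \<Rightarrow> 'm \<Rightarrow> 'm \<Rightarrow> 'm \<Rightarrow> 'm \<Rightarrow> bool" where
  "direct_sum C X Y S i j p q \<longleftrightarrow>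
     X \<in> Obj C \<and> Y \<in> Obj C \<and> S \<in> Obj C \<and>
     i \<in> Mor C X S \<and> j \<in> Mor C Y S \<and> p \<in> Mor C S X \<and> q \<in> Mor C S Y \<and>
     p \<cdot>\<^bsub>C\<^esub> i = Ident C X \<and> q \<cdot>\<^bsub>C\<^esub> j = Ident C Y \<and>
     p \<cdot>\<^bsub>C\<^esub> j = Zero C Y X \<and> q \<cdot>\<^bsub>C\<^esub> i = Zero C X Y \<and>
     (i \<cdot>\<^bsub>C\<^esub> p) \<boxplus>\<^bsub>C\<^esub> (j \<cdot>\<^bsub>C\<^esub> q) = Ident C S"

definition is_kernel :: "('o, 'm, 'z) cat_data_scheme \<Rightarrow> 'm \<Rightarrow> 'm \<Rightarrow> bool" where
  "is_kernel C f k \<longleftrightarrow> f \<in> Arr C \<and> k \<in> Arr C \<and> Cod C k = Dom C f \<and>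
     f \<cdot>\<^bsub>C\<^esub> k = Zero C (Dom C k) (Cod C f) \<and>
     (\<forall>W \<in> Obj C. \<forall>h \<in> Mor C W (Dom C f). f \<cdot>\<^bsub>C\<^esub> h = Zero C W (Cod C f) \<longrightarrow>
        (\<exists>!u. u \<in> Mor C W (Dom C k) \<and> k \<cdot>\<^bsub>C\<^esub> u = h))"

definition is_cokernel :: "('o, 'm, 'z) cat_data_scheme \<Rightarrow> 'm \<Rightarrow> 'm \<Rightarrow> bool" where
  "is_cokernel C f c \<longleftrightarrow> f \<in> Arr C \<and> c \<in> Arr C \<and> Dom C c = Cod C f \<and>
     c \<cdot>\<^bsub>C\<^esub> f = Zero C (Dom C f) (Cod C c) \<and>
     (\<forall>W \<in> Obj C. \<forall>h \<in> Mor C (Cod C f) W. h \<cdot>\<^bsub>C\<^esub> f = Zero C (Dom C f) W \<longrightarrow>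
        (\<exists>!u. u \<in> Mor C (Cod C c) W \<and> u \<cdot>\<^bsub>C\<^esub> c = h))"

locale abelian_category = preadditive_category +
  assumes ex_zero_object: "\<exists>Z. zero_object C Z"
    and ex_direct_sum: "\<lbrakk>X \<in> Obj C; Y \<in> Obj C\<rbrakk> \<Longrightarrow> \<exists>S i j p q. direct_sum C X Y S i j p q"
    and ex_kernel: "f \<in> Arr C \<Longrightarrow> \<exists>k. is_kernel C f k"
    and ex_cokernel: "f \<in> Arr C \<Longrightarrow> \<exists>c. is_cokernel C f c"
    and monic_is_kernel: "monic C m \<Longrightarrow> \<exists>f. is_kernel C f m"
    and epic_is_cokernel: "epic C e \<Longrightarrow> \<exists>f. is_cokernel C f e"

definition simple_object :: "('o, 'm, 'z) cat_data_scheme \<Rightarrow> 'o \<Rightarrow> bool" where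
  "simple_object C S \<longleftrightarrow> S \<in> Obj C \<and> \<not> zero_object C S \<and>
     (\<forall>m. monic C m \<and> Cod C m = S \<longrightarrow> zero_object C (Dom C m) \<or> isomorphism C m)"

text \<open>A composition series
  \<open>0 = F 0 \<hookrightarrow> F 1 \<hookrightarrow> \<dots> \<hookrightarrow> F n = X\<close> with simple subquotients.\<close>

definition finite_length :: "('o, 'm, 'z) cat_data_scheme \<Rightarrow> 'o \<Rightarrow> bool" where
  "finite_length C X \<longleftrightarrow> (\<exists>(n::nat) F m. zero_object C (F 0) \<and> F n = X \<and>
     (\<forall>k<n. m k \<in> Mor C (F k) (F (Suc k)) \<and> monic C (m k) \<and>
            (\<exists>c. is_cokernel C (m k) c \<and> simple_object C (Cod C c))))"

locale abelian_length_category = abelian_category +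
  assumes finite_length: "X \<in> Obj C \<Longrightarrow> finite_length C X"


section \<open>Yoneda extension groups\<close>

definition is_image :: "('o, 'm, 'z) cat_data_scheme \<Rightarrow> 'm \<Rightarrow> 'm \<Rightarrow> bool" where
  "is_image C f m \<longleftrightarrow> (\<exists>c. is_cokernel C f c \<and> is_kernel C c m)"

text \<open>Exactness of \<open>X \<rightarrow> Y \<rightarrow> Z\<close> at \<open>Y\<close>: the image of the first map and the kernel of the
  second are the same subobject of \<open>Y\<close>.\<close>

definition exact_at :: "('o, 'm, 'z) cat_data_scheme \<Rightarrow> 'm \<Rightarrow> 'm \<Rightarrow> bool" where
  "exact_at C f g \<longleftrightarrow> (\<exists>m. is_image C f m \<and> is_kernel C g m)"

text \<open>An \<open>n\<close>-fold extension of \<open>X\<close> by \<open>Y\<close> is an exact sequence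
  \<open>0 \<rightarrow> Y \<rightarrow> E\<^sub>n \<rightarrow> \<dots> \<rightarrow> E\<^sub>1 \<rightarrow> X \<rightarrow> 0\<close>, given as the list of its \<open>n + 1\<close> maps
  from left to right, without the two outer ones.\<close>

definition extension :: "('o, 'm, 'z) cat_data_scheme \<Rightarrow> nat \<Rightarrow> 'o \<Rightarrow> 'o \<Rightarrow> 'm list \<Rightarrow> bool" where
  "extension C n X Y fs \<longleftrightarrow> length fs = Suc n \<and> set fs \<subseteq> Arr C \<and>
     Dom C (fs ! 0) = Y \<and> Cod C (fs ! n) = X \<and>
     (\<forall>k<n. Cod C (fs ! k) = Dom C (fs ! Suc k)) \<and>
     monic C (fs ! 0) \<and> (\<forall>k<n. exact_at C (fs ! k) (fs ! Suc k)) \<and> epic C (fs ! n)"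

text \<open>A morphism of extensions is a commutative ladder which is the identity on both ends; the
  vertical map \<open>u k\<close> starts at the source of the \<open>k\<close>-th map.\<close>

definition extension_morphism ::
  "('o, 'm, 'z) cat_data_scheme \<Rightarrow> nat \<Rightarrow> 'o \<Rightarrow> 'o \<Rightarrow> 'm list \<Rightarrow> 'm list \<Rightarrow> (nat \<Rightarrow> 'm) \<Rightarrow> bool" where
  "extension_morphism C n X Y fs gs u \<longleftrightarrow>
     u 0 = Ident C Y \<and> u (Suc n) = Ident C X \<and>
     (\<forall>k\<le>n. u k \<in> Mor C (Dom C (fs ! k)) (Dom C (gs ! k)) \<and>
            u (Suc k) \<in> Mor C (Cod C (fs ! k)) (Cod C (gs ! k)) \<and>
            gs ! k \<cdot>\<^bsub>C\<^esub> u k = u (Suc k) \<cdot>\<^bsub>C\<^esub> fs ! k)"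

definition extension_rel ::
  "('o, 'm, 'z) cat_data_scheme \<Rightarrow> nat \<Rightarrow> 'o \<Rightarrow> 'o \<Rightarrow> ('m list \<times> 'm list) set" where
  "extension_rel C n X Y = {(fs, gs). extension C n X Y fs \<and> extension C n X Y gs \<and>
     (\<exists>u. extension_morphism C n X Y fs gs u)}"

text \<open>Underlying set of the Yoneda group \<open>Ext\<^sup>n(X, Y)\<close>, for \<open>n \<ge> 1\<close>: extensions modulo
  the equivalence relation generated by the existence of a morphism of extensions.\<close>

definition Ext :: "('o, 'm, 'z) cat_data_scheme \<Rightarrow> nat \<Rightarrow> 'o \<Rightarrow> 'o \<Rightarrow> 'm list set set" where
  "Ext C n X Y = {fs. extension C n X Y fs} //
     (extension_rel C n X Y \<union> (extension_rel C n X Y)\<inverse>)\<^sup>*"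

text \<open>The Baer sum makes \<open>Ext\<^sup>n(X, Y)\<close> a group; only its vanishing is needed, and a group is
  zero iff it has exactly one element.\<close>

definition Ext_vanishes :: "('o, 'm, 'z) cat_data_scheme \<Rightarrow> nat \<Rightarrow> 'o \<Rightarrow> 'o \<Rightarrow> bool" where
  "Ext_vanishes C n X Y \<longleftrightarrow> is_singleton (Ext C n X Y)"


section \<open>Cluster tilting subcategories\<close>

text \<open>Full subcategories are given by their sets of objects. The empty direct sum is a zero
  object.\<close>

definition additive_subcategory :: "('o, 'm, 'z) cat_data_scheme \<Rightarrow> 'o set \<Rightarrow> bool" where
  "additive_subcategory C \<X> \<longleftrightarrow> \<X> \<subseteq> Obj C \<and>
     (\<forall>X \<in> \<X>. \<forall>f. isomorphism C f \<and> Dom C f = X \<longrightarrow> Cod C f \<in> \<X>) \<and>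
     (\<forall>Z. zero_object C Z \<longrightarrow> Z \<in> \<X>) \<and>
     (\<forall>X Y S i j p q. direct_sum C X Y S i j p q \<and> X \<in> \<X> \<and> Y \<in> \<X> \<longrightarrow> S \<in> \<X>) \<and>
     (\<forall>X Y S i j p q. direct_sum C X Y S i j p q \<and> S \<in> \<X> \<longrightarrow> X \<in> \<X>)"

definition generating :: "('o, 'm, 'z) cat_data_scheme \<Rightarrow> 'o set \<Rightarrow> bool" where
  "generating C \<X> \<longleftrightarrow> (\<forall>Y \<in> Obj C. \<exists>X \<in> \<X>. \<exists>e \<in> Mor C X Y. epic C e)"

definition cogenerating :: "('o, 'm, 'z) cat_data_scheme \<Rightarrow> 'o set \<Rightarrow> bool" where
  "cogenerating C \<X> \<longleftrightarrow> (\<forall>Y \<in> Obj C. \<exists>X \<in> \<X>. \<exists>m \<in> Mor C Y X. monic C m)"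

definition left_approximation :: "('o, 'm, 'z) cat_data_scheme \<Rightarrow> 'o set \<Rightarrow> 'o \<Rightarrow> 'm \<Rightarrow> bool" where
  "left_approximation C \<X> Y a \<longleftrightarrow> (\<exists>X \<in> \<X>. a \<in> Mor C Y X \<and>
     (\<forall>X' \<in> \<X>. \<forall>h \<in> Mor C Y X'. \<exists>u \<in> Mor C X X'. h = u \<cdot>\<^bsub>C\<^esub> a))"

definition right_approximation :: "('o, 'm, 'z) cat_data_scheme \<Rightarrow> 'o set \<Rightarrow> 'o \<Rightarrow> 'm \<Rightarrow> bool" where
  "right_approximation C \<X> Y a \<longleftrightarrow> (\<exists>X \<in> \<X>. a \<in> Mor C X Y \<and>
     (\<forall>X' \<in> \<X>. \<forall>h \<in> Mor C X' Y. \<exists>u \<in> Mor C X' X. h = a \<cdot>\<^bsub>C\<^esub> u))"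

definition functorially_finite :: "('o, 'm, 'z) cat_data_scheme \<Rightarrow> 'o set \<Rightarrow> bool" where
  "functorially_finite C \<X> \<longleftrightarrow>
     (\<forall>Y \<in> Obj C. (\<exists>a. left_approximation C \<X> Y a) \<and> (\<exists>a. right_approximation C \<X> Y a))"

definition cluster_tilting :: "('o, 'm, 'z) cat_data_scheme \<Rightarrow> nat \<Rightarrow> 'o set \<Rightarrow> bool" where
  "cluster_tilting C d \<M> \<longleftrightarrow> additive_subcategory C \<M> \<and> functorially_finite C \<M> \<and>
     generating C \<M> \<and> cogenerating C \<M> \<and>
     \<M> = {X \<in> Obj C. \<forall>M \<in> \<M>. \<forall>i \<in> {1..d - 1}. Ext_vanishes C i X M} \<and>
     \<M> = {Y \<in> Obj C. \<forall>M \<in> \<M>. \<forall>i \<in> {1..d - 1}. Ext_vanishes C i M Y}"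


section \<open>Left minimal weak cokernels\<close>

definition left_minimal :: "('o, 'm, 'z) cat_data_scheme \<Rightarrow> 'm \<Rightarrow> bool" where
  "left_minimal C f \<longleftrightarrow> f \<in> Arr C \<and>
     (\<forall>g \<in> Mor C (Cod C f) (Cod C f). g \<cdot>\<^bsub>C\<^esub> f = f \<longrightarrow> isomorphism C g)"

text \<open>The image of \<open>Hom(Z, M) \<rightarrow> Hom(Y, M)\<close> is the kernel of \<open>Hom(Y, M) \<rightarrow> Hom(X, M)\<close>.\<close>

definition weak_cokernel_of :: "('o, 'm, 'z) cat_data_scheme \<Rightarrow> 'o set \<Rightarrow> 'm \<Rightarrow> 'm \<Rightarrow> bool" where
  "weak_cokernel_of C \<M> f g \<longleftrightarrow> (\<exists>X \<in> \<M>. \<exists>Y \<in> \<M>. \<exists>Z \<in> \<M>. f \<in> Mor C X Y \<and> g \<in> Mor C Y Z \<and>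
     (\<forall>M \<in> \<M>. (\<lambda>h. h \<cdot>\<^bsub>C\<^esub> g) ` Mor C Z M = {h \<in> Mor C Y M. h \<cdot>\<^bsub>C\<^esub> f = Zero C X M}))"

definition weak_cokernel :: "('o, 'm, 'z) cat_data_scheme \<Rightarrow> 'o set \<Rightarrow> 'm \<Rightarrow> bool" where
  "weak_cokernel C \<M> g \<longleftrightarrow> (\<exists>f. weak_cokernel_of C \<M> f g)"

text \<open>Composites of one or more arrows satisfying \<open>P\<close>. Identities of objects of \<open>\<M>\<close> are left
  minimal weak cokernels (of \<open>0 \<rightarrow> M\<close>), so for these the empty composite adds nothing.\<close>

inductive composite_of :: "('o, 'm, 'z) cat_data_scheme \<Rightarrow> ('m \<Rightarrow> bool) \<Rightarrow> 'm \<Rightarrow> bool"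
  for C P where
  single: "\<lbrakk>f \<in> Arr C; P f\<rbrakk> \<Longrightarrow> composite_of C P f"
| comp: "\<lbrakk>composite_of C P f; g \<in> Arr C; P g; Dom C g = Cod C f\<rbrakk> \<Longrightarrow> composite_of C P (g \<cdot>\<^bsub>C\<^esub> f)"

end

theory Submission
  imports Defs
begin

text \<open>
  Let \<open>f: M \<rightarrow> N\<close> have image \<open>I\<close>, so that \<open>f = m e\<close> with \<open>e: M \<rightarrow> I\<close> epic and
  \<open>m: I \<rightarrow> N\<close> monic, and let \<open>a: I \<rightarrow> X\<close> be a left minimal left approximation. The composite
  \<open>a e\<close> is left minimal because \<open>e\<close> is epic. It is a weak cokernel of \<open>P \<rightarrow> ker f \<rightarrow> M\<close>, where
  \<open>P \<rightarrow> ker f\<close> is an epimorphism from an object of the subcategory: a morphism out of \<open>M\<close>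
  kills \<open>P\<close> iff it kills \<open>ker f = ker e\<close>, iff it factors through \<open>I\<close>, and if its target lies in
  the subcategory, iff it factors through \<open>X\<close>. Since \<open>N\<close> lies in the subcategory, \<open>m = f' a\<close> for
  some \<open>f': X \<rightarrow> N\<close>, and \<open>f = f' (a e)\<close> splits off one left minimal weak cokernel.

  The procedure is now applied to \<open>f'\<close>. It stops because the images grow inside \<open>N\<close>, which has
  finite length: the image \<open>I'\<close> of \<open>f'\<close> contains \<open>I\<close>, and if \<open>I' = I\<close>, then \<open>f'\<close>
  gives a retraction \<open>r\<close> of \<open>a\<close>. As \<open>(a r) a = a\<close>, left minimality makes \<open>a r\<close> an isomorphism,
  so \<open>r\<close> is monic, and then \<open>f'\<close> is monic as well. This is
  \<open>monic_of_left_minimal_retract\<close>; the induction is \<open>factorisation_through_weak_cokernels\<close>.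

  Left minimal left approximations are obtained in \<open>ex_left_minimal_left_approximation\<close> by taking
  a left approximation \<open>a: I \<rightarrow> X\<close> with \<open>X\<close> of least length. An endomorphism \<open>g\<close> of \<open>X\<close> with
  \<open>g a = a\<close> and with kernel of maximal length satisfies \<open>ker (g g) = ker g\<close>, so its image is a
  direct summand of \<open>X\<close> through which \<open>a\<close> still factors as a left approximation; by the
  choice of \<open>X\<close>, the image is all of \<open>X\<close> and \<open>g\<close> is monic. By the choice of \<open>g\<close>, all \<open>g\<close> with
  \<open>g a = a\<close> are then monic, hence isomorphisms.

  All that these arguments ask of a length function with values in the natural numbers is that it
  is invariant under isomorphism, decreases strictly on proper subobjects and vanishes exactly on
  zero objects. The least length of a composition series has these properties
  (\<open>len_isomorphic\<close>, \<open>len_proper_subobject\<close>, \<open>len_zero_iff\<close>).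
\<close>

section \<open>Zero morphisms, monomorphisms and epimorphisms\<close>

context preadditive_category
begin

lemma Mor_Obj: "f \<in> Mor C X Y \<Longrightarrow> X \<in> Obj C" "f \<in> Mor C X Y \<Longrightarrow> Y \<in> Obj C"
  using Dom_Obj Cod_Obj by (auto simp: Mor_def)

lemma carrier_Mor_group: "carrier (Mor_group C X Y) = Mor C X Y"
  by (simp add: Mor_group_def)

lemma Zero_Mor: "\<lbrakk>X \<in> Obj C; Y \<in> Obj C\<rbrakk> \<Longrightarrow> Zero C X Y \<in> Mor C X Y"
  using monoid.one_closed[of "Mor_group C X Y"] Mor_comm_group[of X Y]
  by (simp add: Mor_group_def comm_group_def group_def)

lemma Add_cancel_Zero:
  assumes "f \<in> Mor C X Y" "f \<boxplus> f = f"
  shows "f = Zero C X Y"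
proof -
  interpret comm_group "Mor_group C X Y"
    using assms Mor_Obj Mor_comm_group by blast
  show ?thesis
    using assms r_cancel_one[of f f] by (simp add: Mor_group_def)
qed

lemma Zero_Add: "f \<in> Mor C X Y \<Longrightarrow> Zero C X Y \<boxplus> f = f"
  using Mor_comm_group[of X Y] Mor_Obj monoid.l_one[of "Mor_group C X Y" f]
  by (simp add: Mor_group_def comm_group_def group_def)

lemma Add_commute:
  assumes "f \<in> Mor C X Y" "g \<in> Mor C X Y"
  shows "f \<boxplus> g = g \<boxplus> f"
  using Mor_comm_group[of X Y] Mor_Obj[of f X Y] assms
    comm_monoid.m_comm[of "Mor_group C X Y" f g]
  by (simp add: Mor_group_def comm_group_def)

lemma Add_Zero: "f \<in> Mor C X Y \<Longrightarrow> f \<boxplus> Zero C X Y = f"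
  using Add_commute[of f X Y "Zero C X Y"] Zero_Add Zero_Mor Mor_Obj by metis

lemma ex_difference:
  assumes "f \<in> Mor C X Y" "g \<in> Mor C X Y"
  shows "\<exists>d \<in> Mor C X Y. d \<boxplus> g = f"
proof -
  interpret comm_group "Mor_group C X Y"
    using assms Mor_Obj Mor_comm_group by blast
  let ?d = "f \<otimes>\<^bsub>Mor_group C X Y\<^esub> inv\<^bsub>Mor_group C X Y\<^esub> g"
  have fg: "f \<in> carrier (Mor_group C X Y)" "g \<in> carrier (Mor_group C X Y)"
    using assms by (auto simp: carrier_Mor_group)
  then have "?d \<otimes>\<^bsub>Mor_group C X Y\<^esub> g = f"
    by (simp add: m_assoc)
  moreover have "?d \<in> carrier (Mor_group C X Y)"
    using fg by simp
  ultimately show ?thesis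
    by (auto simp: Mor_group_def)
qed

lemma Add_left_cancel_Zero:
  assumes "f \<in> Mor C X Y" "g \<in> Mor C X Y" "f \<boxplus> g = g"
  shows "f = Zero C X Y"
proof -
  interpret comm_group "Mor_group C X Y"
    using assms Mor_Obj Mor_comm_group by blast
  show ?thesis
    using assms r_cancel_one'[of g f] l_cancel_one'[of g f]
    by (auto simp: Mor_group_def)
qed

lemma Comp_Zero:
  assumes "g \<in> Mor C Y Z" "X \<in> Obj C"
  shows "g \<cdot> Zero C X Y = Zero C X Z"
proof -
  have z: "Zero C X Y \<in> Mor C X Y"
    using assms Mor_Obj Zero_Mor by blast
  show ?thesis
    using Comp_Add_right[OF z z assms(1)] Comp_Mor[OF z assms(1)] Zero_Add[OF z]
    by (intro Add_cancel_Zero) auto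
qed

lemma Zero_Comp:
  assumes "f \<in> Mor C X Y" "Z \<in> Obj C"
  shows "Zero C Y Z \<cdot> f = Zero C X Z"
proof -
  have z: "Zero C Y Z \<in> Mor C Y Z"
    using assms Mor_Obj Zero_Mor by blast
  show ?thesis
    using Comp_Add_left[OF assms(1) z z] Comp_Mor[OF assms(1) z] Zero_Add[OF z]
    by (intro Add_cancel_Zero) auto
qed

lemma monicD:
  "\<lbrakk>monic C f; f \<in> Mor C X Y; g \<in> Mor C W X; h \<in> Mor C W X; f \<cdot> g = f \<cdot> h\<rbrakk> \<Longrightarrow> g = h"
  using Mor_Obj[of g W X] by (auto simp: monic_def Mor_def)

lemma epicD:
  "\<lbrakk>epic C f; f \<in> Mor C X Y; g \<in> Mor C Y W; h \<in> Mor C Y W; g \<cdot> f = h \<cdot> f\<rbrakk> \<Longrightarrow> g = h"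
  using Mor_Obj[of g Y W] by (auto simp: epic_def Mor_def)

lemma monic_cancel_Zero:
  "\<lbrakk>monic C f; f \<in> Mor C X Y; g \<in> Mor C W X; f \<cdot> g = Zero C W Y\<rbrakk> \<Longrightarrow> g = Zero C W X"
  by (metis Comp_Zero Mor_Obj Zero_Mor monicD)

lemma epic_cancel_Zero:
  "\<lbrakk>epic C f; f \<in> Mor C X Y; g \<in> Mor C Y W; g \<cdot> f = Zero C X W\<rbrakk> \<Longrightarrow> g = Zero C Y W"
  by (metis Zero_Comp Mor_Obj Zero_Mor epicD)

lemma monicI:
  assumes f: "f \<in> Mor C X Y"
    and zero: "\<And>W h. \<lbrakk>h \<in> Mor C W X; f \<cdot> h = Zero C W Y\<rbrakk> \<Longrightarrow> h = Zero C W X"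
  shows "monic C f"
proof -
  have "g = h" if g: "g \<in> Mor C W X" and h: "h \<in> Mor C W X" and eq: "f \<cdot> g = f \<cdot> h" for W g h
  proof -
    obtain d where d: "d \<in> Mor C W X" and dh: "d \<boxplus> h = g"
      using ex_difference[OF g h] by blast
    have "f \<cdot> d \<boxplus> f \<cdot> h = f \<cdot> h"
      using Comp_Add_right[OF d h f] dh eq by simp
    then have "f \<cdot> d = Zero C W Y"
      using Add_left_cancel_Zero Comp_Mor d f h by blast
    then show ?thesis
      using zero d dh Zero_Add h by metis
  qed
  with f show ?thesis
    by (auto simp: monic_def Mor_def)
qed

lemma epicI:
  assumes f: "f \<in> Mor C X Y"
    and zero: "\<And>W h. \<lbrakk>h \<in> Mor C Y W; h \<cdot> f = Zero C X W\<rbrakk> \<Longrightarrow> h = Zero C Y W"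
  shows "epic C f"
proof -
  have "g = h" if g: "g \<in> Mor C Y W" and h: "h \<in> Mor C Y W" and eq: "g \<cdot> f = h \<cdot> f" for W g h
  proof -
    obtain d where d: "d \<in> Mor C Y W" and dh: "d \<boxplus> h = g"
      using ex_difference[OF g h] by blast
    have "d \<cdot> f \<boxplus> h \<cdot> f = h \<cdot> f"
      using Comp_Add_left[OF f d h] dh eq by simp
    then have "d \<cdot> f = Zero C X W"
      using Add_left_cancel_Zero Comp_Mor d f h by blast
    then show ?thesis
      using zero d dh Zero_Add h by metis
  qed
  with f show ?thesis
    by (auto simp: epic_def Mor_def)
qed

lemma monic_Comp:
  assumes "f \<in> Mor C X Y" "g \<in> Mor C Y Z" "monic C f" "monic C g"
  shows "monic C (g \<cdot> f)"
proof (rule monicI)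
  show "g \<cdot> f \<in> Mor C X Z"
    using assms Comp_Mor by blast
  fix W h assume h: "h \<in> Mor C W X" and "(g \<cdot> f) \<cdot> h = Zero C W Z"
  then have "g \<cdot> (f \<cdot> h) = Zero C W Z"
    using Comp_assoc assms by metis
  then show "h = Zero C W X"
    using monic_cancel_Zero assms h Comp_Mor by blast
qed

lemma epic_Comp:
  assumes "f \<in> Mor C X Y" "g \<in> Mor C Y Z" "epic C f" "epic C g"
  shows "epic C (g \<cdot> f)"
proof (rule epicI)
  show "g \<cdot> f \<in> Mor C X Z"
    using assms Comp_Mor by blast
  fix W h assume h: "h \<in> Mor C Z W" and "h \<cdot> (g \<cdot> f) = Zero C X W"
  then have "(h \<cdot> g) \<cdot> f = Zero C X W"
    using Comp_assoc assms by metis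
  then show "h = Zero C Z W"
    using epic_cancel_Zero assms h Comp_Mor by blast
qed

lemma monic_Comp_right:
  assumes "f \<in> Mor C X Y" "g \<in> Mor C Y Z" "monic C (g \<cdot> f)"
  shows "monic C f"
proof (rule monicI)
  show f: "f \<in> Mor C X Y" by fact
  fix W h assume h: "h \<in> Mor C W X" and "f \<cdot> h = Zero C W Y"
  then have "(g \<cdot> f) \<cdot> h = Zero C W Z"
    using Comp_assoc[OF h f assms(2)] Comp_Zero[OF assms(2)] Mor_Obj[OF h] by simp
  then show "h = Zero C W X"
    using monic_cancel_Zero assms h Comp_Mor by blast
qed

lemma isomorphismI:
  "\<lbrakk>f \<in> Mor C X Y; g \<in> Mor C Y X; g \<cdot> f = Ident C X; f \<cdot> g = Ident C Y\<rbrakk> \<Longrightarrow> isomorphism C f"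
  by (auto simp: isomorphism_def Mor_def)

lemma isomorphismE:
  assumes "isomorphism C f" "f \<in> Mor C X Y"
  obtains g where "g \<in> Mor C Y X" "g \<cdot> f = Ident C X" "f \<cdot> g = Ident C Y"
  using assms by (auto simp: isomorphism_def Mor_def)

lemma split_mono_monic:
  assumes "f \<in> Mor C X Y" "g \<in> Mor C Y X" "g \<cdot> f = Ident C X"
  shows "monic C f"
proof (rule monicI)
  show "f \<in> Mor C X Y" by fact
  fix W h assume "h \<in> Mor C W X" "f \<cdot> h = Zero C W Y"
  then show "h = Zero C W X"
    using assms Comp_assoc[of h W X f Y g X] Comp_Zero[of g Y X W] Ident_Comp Mor_Obj by metis
qed

lemma split_epi_epic:
  assumes "f \<in> Mor C X Y" "g \<in> Mor C Y X" "f \<cdot> g = Ident C Y"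
  shows "epic C f"
proof (rule epicI)
  show "f \<in> Mor C X Y" by fact
  fix W h assume "h \<in> Mor C Y W" "h \<cdot> f = Zero C X W"
  then show "h = Zero C Y W"
    using assms Comp_assoc[of g Y X f Y h W] Zero_Comp[of g Y X W] Comp_Ident Mor_Obj by metis
qed

lemma isomorphism_monic: "isomorphism C f \<Longrightarrow> monic C f"
  using split_mono_monic[of f "Dom C f" "Cod C f"] by (auto simp: isomorphism_def Mor_def)

lemma isomorphism_epic: "isomorphism C f \<Longrightarrow> epic C f"
  using split_epi_epic[of f "Dom C f" "Cod C f"] by (auto simp: isomorphism_def Mor_def)

lemma kernel_Mor:
  assumes "is_kernel C f k" "f \<in> Mor C X Y"
  shows "k \<in> Mor C (Dom C k) X"
  using assms by (auto simp: is_kernel_def Mor_def)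

lemma cokernel_Mor:
  assumes "is_cokernel C f c" "f \<in> Mor C X Y"
  shows "c \<in> Mor C Y (Cod C c)"
  using assms by (auto simp: is_cokernel_def Mor_def)

lemma kernelD:
  assumes ker: "is_kernel C f k" and f: "f \<in> Mor C X Y" and k: "k \<in> Mor C K X"
  shows "f \<cdot> k = Zero C K Y" and "monic C k"
    and "\<lbrakk>h \<in> Mor C W X; f \<cdot> h = Zero C W Y\<rbrakk> \<Longrightarrow> \<exists>u \<in> Mor C W K. k \<cdot> u = h"
proof -
  show "f \<cdot> k = Zero C K Y"
    using assms by (auto simp: is_kernel_def Mor_def)
  have ex1: "\<exists>!u. u \<in> Mor C W K \<and> k \<cdot> u = h"
    if "h \<in> Mor C W X" "f \<cdot> h = Zero C W Y" for W h
    using assms that Mor_Obj[OF that(1)] by (auto simp: is_kernel_def Mor_def)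
  then show "\<lbrakk>h \<in> Mor C W X; f \<cdot> h = Zero C W Y\<rbrakk> \<Longrightarrow> \<exists>u \<in> Mor C W K. k \<cdot> u = h"
    by blast
  show "monic C k"
  proof (rule monicI[OF k])
    fix W h assume h: "h \<in> Mor C W K" and kh: "k \<cdot> h = Zero C W X"
    have z: "Zero C W X \<in> Mor C W X" "f \<cdot> Zero C W X = Zero C W Y"
      using h k f Mor_Obj Zero_Mor Comp_Zero by blast+
    have "Zero C W K \<in> Mor C W K" "k \<cdot> Zero C W K = Zero C W X"
      using h k Mor_Obj Zero_Mor Comp_Zero by blast+
    with ex1[OF z] h kh show "h = Zero C W K" by blast
  qed
qed

lemma cokernelD:
  assumes cok: "is_cokernel C f c" and f: "f \<in> Mor C X Y" and c: "c \<in> Mor C Y Q"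
  shows "c \<cdot> f = Zero C X Q" and "epic C c"
    and "\<lbrakk>h \<in> Mor C Y W; h \<cdot> f = Zero C X W\<rbrakk> \<Longrightarrow> \<exists>u \<in> Mor C Q W. u \<cdot> c = h"
proof -
  show "c \<cdot> f = Zero C X Q"
    using assms by (auto simp: is_cokernel_def Mor_def)
  have ex1: "\<exists>!u. u \<in> Mor C Q W \<and> u \<cdot> c = h"
    if "h \<in> Mor C Y W" "h \<cdot> f = Zero C X W" for W h
    using assms that Mor_Obj[OF that(1)] by (auto simp: is_cokernel_def Mor_def)
  then show "\<lbrakk>h \<in> Mor C Y W; h \<cdot> f = Zero C X W\<rbrakk> \<Longrightarrow> \<exists>u \<in> Mor C Q W. u \<cdot> c = h"
    by blast
  show "epic C c"
  proof (rule epicI[OF c])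
    fix W h assume h: "h \<in> Mor C Q W" and hc: "h \<cdot> c = Zero C Y W"
    have z: "Zero C Y W \<in> Mor C Y W" "Zero C Y W \<cdot> f = Zero C X W"
      using h c f Mor_Obj Zero_Mor Zero_Comp by blast+
    have "Zero C Q W \<in> Mor C Q W" "Zero C Q W \<cdot> c = Zero C Y W"
      using h c Mor_Obj Zero_Mor Zero_Comp by blast+
    with ex1[OF z] h hc show "h = Zero C Q W" by blast
  qed
qed

lemma is_cokernelI:
  assumes f: "f \<in> Mor C X Y" and c: "c \<in> Mor C Y Q" and "c \<cdot> f = Zero C X Q" and e: "epic C c"
    and "\<And>W h. \<lbrakk>h \<in> Mor C Y W; h \<cdot> f = Zero C X W\<rbrakk> \<Longrightarrow> \<exists>u \<in> Mor C Q W. u \<cdot> c = h"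
  shows "is_cokernel C f c"
proof -
  have "\<exists>!u. u \<in> Mor C Q W \<and> u \<cdot> c = h" if "h \<in> Mor C Y W" "h \<cdot> f = Zero C X W" for W h
    using assms(5)[OF that] epicD[OF e c] by metis
  moreover have "f \<in> Arr C" "Dom C f = X" "Cod C f = Y" "c \<in> Arr C" "Dom C c = Y" "Cod C c = Q"
    using f c by (auto simp: Mor_def)
  ultimately show ?thesis
    using assms(3) by (simp add: is_cokernel_def)
qed

lemma zero_object_Mor:
  assumes "zero_object C Z"
  shows "f \<in> Mor C X Z \<Longrightarrow> f = Zero C X Z" "f \<in> Mor C Z X \<Longrightarrow> f = Zero C Z X"
  using assms Mor_Obj Zero_Mor by (metis zero_object_def)+

lemma zero_objectI:
  assumes Z: "Z \<in> Obj C" and id: "Ident C Z = Zero C Z Z"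
  shows "zero_object C Z"
proof -
  have "f = Zero C X Z" if "f \<in> Mor C X Z" for X f
    using that Ident_Comp[OF that] id Zero_Comp Z by metis
  moreover have "f = Zero C Z X" if "f \<in> Mor C Z X" for X f
    using that Comp_Ident[OF that] id Comp_Zero Z by metis
  ultimately show ?thesis
    using Z Zero_Mor unfolding zero_object_def by blast
qed

lemma zero_object_isomorphic:
  assumes "zero_object C X" "isomorphism C f" "f \<in> Mor C X Y"
  shows "zero_object C Y"
proof -
  obtain g where g: "g \<in> Mor C Y X" "f \<cdot> g = Ident C Y"
    using isomorphismE assms by metis
  have "Ident C Y = Zero C Y Y"
    using g zero_object_Mor(1)[OF assms(1) g(1)] Comp_Zero[OF assms(3)] Mor_Obj[OF g(1)] by simp
  then show ?thesis
    using zero_objectI Mor_Obj assms by blast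
qed

text \<open>A retract is a direct summand as soon as the retraction has a kernel: the complement is
  the image of the idempotent \<open>1 - m r\<close>, which is the kernel of \<open>r\<close>.\<close>

lemma retract_direct_sum:
  assumes m: "m \<in> Mor C J X" and r: "r \<in> Mor C X J" and rm: "r \<cdot> m = Ident C J"
    and ker: "is_kernel C r j"
  shows "\<exists>Y q. direct_sum C J Y X m j r q"
proof -
  obtain Y where j: "j \<in> Mor C Y X" and rj: "r \<cdot> j = Zero C Y J" and mj: "monic C j"
    and univ: "\<And>W h. \<lbrakk>h \<in> Mor C W X; r \<cdot> h = Zero C W J\<rbrakk> \<Longrightarrow> \<exists>u \<in> Mor C W Y. j \<cdot> u = h"
    using kernelD[OF ker r] kernel_Mor[OF ker r] by metis
  have obj: "J \<in> Obj C" "X \<in> Obj C" "Y \<in> Obj C"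
    using m j Mor_Obj by blast+
  have mr: "m \<cdot> r \<in> Mor C X X"
    using m r Comp_Mor by blast
  have rmr: "r \<cdot> (m \<cdot> r) = r" and mrm: "(m \<cdot> r) \<cdot> m = m"
    using Comp_assoc[OF r m r] Comp_assoc[OF m r m] rm Ident_Comp[OF r] Comp_Ident[OF m] by auto
  obtain d where d: "d \<in> Mor C X X" and dmr: "d \<boxplus> m \<cdot> r = Ident C X"
    using ex_difference[OF Ident_Mor[OF obj(2)] mr] by blast
  have "r \<cdot> d \<boxplus> r = r"
    using Comp_Add_right[OF d mr r] dmr rmr Comp_Ident[OF r] by simp
  then have "r \<cdot> d = Zero C X J"
    using Add_left_cancel_Zero Comp_Mor d r by blast
  then obtain q where q: "q \<in> Mor C X Y" and jq: "j \<cdot> q = d"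
    using univ[OF d] by blast
  have "d \<cdot> m \<boxplus> m = m"
    using Comp_Add_left[OF m d mr] dmr mrm Ident_Comp[OF m] by simp
  then have "d \<cdot> m = Zero C J X"
    using Add_left_cancel_Zero Comp_Mor d m by blast
  then have "j \<cdot> (q \<cdot> m) = Zero C J X"
    using Comp_assoc[OF m q j] jq by simp
  then have qm: "q \<cdot> m = Zero C J Y"
    using monic_cancel_Zero[OF mj j] Comp_Mor m q by blast
  have "(m \<cdot> r) \<cdot> j = Zero C Y X"
    using Comp_assoc[OF j r m] rj Comp_Zero[OF m obj(3)] by simp
  moreover have "d \<cdot> j \<boxplus> (m \<cdot> r) \<cdot> j = j"
    using Comp_Add_left[OF j d mr] dmr Ident_Comp[OF j] by simp
  moreover have dj: "d \<cdot> j \<in> Mor C Y X"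
    using Comp_Mor[OF j d] .
  ultimately have "d \<cdot> j = j"
    using Add_Zero by metis
  then have "j \<cdot> (q \<cdot> j) = j \<cdot> Ident C Y"
    using Comp_assoc[OF j q j] jq Comp_Ident[OF j] by simp
  then have qj: "q \<cdot> j = Ident C Y"
    using monicD[OF mj j] Comp_Mor[OF j q] Ident_Mor[OF obj(3)] by blast
  have "m \<cdot> r \<boxplus> j \<cdot> q = Ident C X"
    using Add_commute[OF mr d] dmr jq by simp
  then show ?thesis
    using obj m r rm j q rj qm qj unfolding direct_sum_def by blast
qed

end


section \<open>Kernels, cokernels and images\<close>

context abelian_category
begin

lemma ex_kernel_Mor:
  assumes "f \<in> Mor C X Y"
  obtains K k where "is_kernel C f k" "k \<in> Mor C K X" "f \<cdot> k = Zero C K Y" "monic C k"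
    "\<And>W h. \<lbrakk>h \<in> Mor C W X; f \<cdot> h = Zero C W Y\<rbrakk> \<Longrightarrow> \<exists>u \<in> Mor C W K. k \<cdot> u = h"
proof -
  obtain k where k: "is_kernel C f k"
    using assms ex_kernel by (auto simp: Mor_def)
  with kernelD[OF k assms] kernel_Mor[OF k assms] that show thesis by metis
qed

lemma ex_cokernel_Mor:
  assumes "f \<in> Mor C X Y"
  obtains Q c where "is_cokernel C f c" "c \<in> Mor C Y Q" "c \<cdot> f = Zero C X Q" "epic C c"
    "\<And>W h. \<lbrakk>h \<in> Mor C Y W; h \<cdot> f = Zero C X W\<rbrakk> \<Longrightarrow> \<exists>u \<in> Mor C Q W. u \<cdot> c = h"
proof -
  obtain c where c: "is_cokernel C f c"
    using assms ex_cokernel by (auto simp: Mor_def)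
  with cokernelD[OF c assms] cokernel_Mor[OF c assms] that show thesis by metis
qed

lemma monic_is_kernel_Mor:
  assumes "monic C m" "m \<in> Mor C X Y"
  obtains Z f where "f \<in> Mor C Y Z" "is_kernel C f m"
  using monic_is_kernel[OF assms(1)] assms(2) by (auto simp: is_kernel_def Mor_def)

lemma epic_is_cokernel_Mor:
  assumes "epic C e" "e \<in> Mor C Y Z"
  obtains X f where "f \<in> Mor C X Y" "is_cokernel C f e"
  using epic_is_cokernel[OF assms(1)] assms(2) by (auto simp: is_cokernel_def Mor_def)

lemma monic_kernel_of_cokernel:
  assumes m: "monic C m" "m \<in> Mor C X Y" and c: "c \<in> Mor C Y Q" "is_cokernel C m c"
    and h: "h \<in> Mor C W Y" "c \<cdot> h = Zero C W Q"
  shows "\<exists>u \<in> Mor C W X. m \<cdot> u = h"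
proof -
  obtain Z f where f: "f \<in> Mor C Y Z" and ker: "is_kernel C f m"
    using monic_is_kernel_Mor m by metis
  have obj: "W \<in> Obj C" "Z \<in> Obj C"
    using h f Mor_Obj by blast+
  have "f \<cdot> m = Zero C X Z"
    using ker f m by (auto simp: is_kernel_def Mor_def)
  then obtain u where u: "u \<in> Mor C Q Z" "u \<cdot> c = f"
    using cokernelD(3)[OF c(2) m(2) c(1) f] by blast
  have "f \<cdot> h = Zero C W Z"
    using Comp_assoc[OF h(1) c(1) u(1)] u(2) h(2) Comp_Zero[OF u(1) obj(1)] by simp
  then show ?thesis
    using kernelD(3)[OF ker f m(2) h(1)] by blast
qed

lemma epic_cokernel_of_kernel:
  assumes e: "epic C e" "e \<in> Mor C Y Z" and k: "k \<in> Mor C K Y" "is_kernel C e k"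
    and h: "h \<in> Mor C Y W" "h \<cdot> k = Zero C K W"
  shows "\<exists>u \<in> Mor C Z W. u \<cdot> e = h"
proof -
  obtain X f where f: "f \<in> Mor C X Y" and cok: "is_cokernel C f e"
    using epic_is_cokernel_Mor e by metis
  have obj: "W \<in> Obj C" "X \<in> Obj C"
    using h f Mor_Obj by blast+
  have "e \<cdot> f = Zero C X Z"
    using cok f e by (auto simp: is_cokernel_def Mor_def)
  then obtain u where u: "u \<in> Mor C X K" "k \<cdot> u = f"
    using kernelD(3)[OF k(2) e(2) k(1) f] by blast
  have "h \<cdot> f = Zero C X W"
    using Comp_assoc[OF u(1) k(1) h(1)] u(2) h(2) Zero_Comp[OF u(1) obj(1)] by simp
  then show ?thesis
    using cokernelD(3)[OF cok f e(2) h(1)] by blast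
qed

lemma monic_epic_isomorphism:
  assumes f: "f \<in> Mor C X Y" and mono: "monic C f" and epi: "epic C f"
  shows "isomorphism C f"
proof -
  have obj: "X \<in> Obj C" "Y \<in> Obj C"
    using f Mor_Obj by blast+
  obtain Q c where c: "is_cokernel C f c" "c \<in> Mor C Y Q" "c \<cdot> f = Zero C X Q"
    using ex_cokernel_Mor[OF f] by metis
  have "c \<cdot> Ident C Y = Zero C Y Q"
    using epic_cancel_Zero[OF epi f c(2,3)] Comp_Ident[OF c(2)] by simp
  then obtain g where g: "g \<in> Mor C Y X" "f \<cdot> g = Ident C Y"
    using monic_kernel_of_cokernel[OF mono f c(2,1)] Ident_Mor obj by blast
  have "f \<cdot> (g \<cdot> f) = f \<cdot> Ident C X"
    using Comp_assoc[OF f g(1) f] g(2) Ident_Comp[OF f] Comp_Ident[OF f] by simp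
  then have "g \<cdot> f = Ident C X"
    using monicD[OF mono f] Comp_Mor[OF f g(1)] Ident_Mor[OF obj(1)] by blast
  then show ?thesis
    using isomorphismI f g by blast
qed

text \<open>The image is the kernel of the cokernel. That the corestriction \<open>e\<close> is epic holds because no
  smaller subobject \<open>m k\<close> of \<open>Y\<close> can contain the image: like every monomorphism, \<open>m k\<close> is itself
  a kernel.\<close>

lemma image_factorisation:
  assumes f: "f \<in> Mor C X Y"
  obtains I e m where "e \<in> Mor C X I" "m \<in> Mor C I Y" "epic C e" "monic C m" "f = m \<cdot> e"
proof -
  obtain Q c where c: "c \<in> Mor C Y Q" "c \<cdot> f = Zero C X Q"
    and c_univ: "\<And>W h. \<lbrakk>h \<in> Mor C Y W; h \<cdot> f = Zero C X W\<rbrakk> \<Longrightarrow> \<exists>u \<in> Mor C Q W. u \<cdot> c = h"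
    using ex_cokernel_Mor[OF f] by metis
  obtain I m where m: "m \<in> Mor C I Y" "c \<cdot> m = Zero C I Q" "monic C m"
    and m_univ: "\<And>W h. \<lbrakk>h \<in> Mor C W Y; c \<cdot> h = Zero C W Q\<rbrakk> \<Longrightarrow> \<exists>u \<in> Mor C W I. m \<cdot> u = h"
    using ex_kernel_Mor[OF c(1)] by metis
  obtain e where e: "e \<in> Mor C X I" "m \<cdot> e = f"
    using m_univ[OF f c(2)] by blast
  have "epic C e"
  proof (rule epicI[OF e(1)])
    fix W h assume h: "h \<in> Mor C I W" and he: "h \<cdot> e = Zero C X W"
    have obj: "I \<in> Obj C"
      using h Mor_Obj by blast
    obtain K k where k: "k \<in> Mor C K I" "h \<cdot> k = Zero C K W" "monic C k"
      and k_univ: "\<And>V g. \<lbrakk>g \<in> Mor C V I; h \<cdot> g = Zero C V W\<rbrakk> \<Longrightarrow> \<exists>u \<in> Mor C V K. k \<cdot> u = g"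
      using ex_kernel_Mor[OF h] by metis
    obtain e' where e': "e' \<in> Mor C X K" "k \<cdot> e' = e"
      using k_univ[OF e(1) he] by blast
    \<comment> \<open>\<open>f\<close> factors through the subobject \<open>m k\<close>. If this is the kernel of \<open>t\<close>, then \<open>t\<close> kills \<open>f\<close>,
      hence factors through \<open>c\<close> and kills \<open>m\<close>, so \<open>m\<close> factors through \<open>m k\<close> as well.\<close>
    have mk: "m \<cdot> k \<in> Mor C K Y" "monic C (m \<cdot> k)"
      using Comp_Mor[OF k(1) m(1)] monic_Comp[OF k(1) m(1) k(3) m(3)] by auto
    obtain Z t where t: "t \<in> Mor C Y Z" and ker: "is_kernel C t (m \<cdot> k)"
      using monic_is_kernel_Mor[OF mk(2,1)] by metis
    have tmk: "t \<cdot> (m \<cdot> k) = Zero C K Z"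
      using ker mk t by (auto simp: is_kernel_def Mor_def)
    have "f = (m \<cdot> k) \<cdot> e'"
      using Comp_assoc[OF e'(1) k(1) m(1)] e'(2) e(2) by simp
    then have "t \<cdot> f = Zero C X Z"
      using Comp_assoc[OF e'(1) mk(1) t] tmk Zero_Comp[OF e'(1)] Mor_Obj[OF t] by simp
    then obtain u where u: "u \<in> Mor C Q Z" "u \<cdot> c = t"
      using c_univ[OF t] by blast
    have "t \<cdot> m = Zero C I Z"
      using Comp_assoc[OF m(1) c(1) u(1)] u(2) m(2) Comp_Zero[OF u(1) obj] by simp
    then obtain v where v: "v \<in> Mor C I K" "(m \<cdot> k) \<cdot> v = m"
      using kernelD(3)[OF ker t mk(1) m(1)] by blast
    then have "m \<cdot> (k \<cdot> v) = m \<cdot> Ident C I"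
      using Comp_assoc[OF v(1) k(1) m(1)] Comp_Ident[OF m(1)] by simp
    then have "k \<cdot> v = Ident C I"
      using monicD[OF m(3,1)] Comp_Mor[OF v(1) k(1)] Ident_Mor[OF obj] by blast
    then show "h = Zero C I W"
      using Comp_assoc[OF v(1) k(1) h] k(2) Comp_Ident[OF h] Zero_Comp[OF v(1)] Mor_Obj[OF h]
      by simp
  qed
  with that e m show thesis by metis
qed

lemma kernel_zero_object_monic:
  assumes f: "f \<in> Mor C X Y" and ker: "is_kernel C f k" and k: "k \<in> Mor C K X"
    and zero: "zero_object C K"
  shows "monic C f"
proof (rule monicI[OF f])
  fix W h assume "h \<in> Mor C W X" "f \<cdot> h = Zero C W Y"
  then obtain u where "u \<in> Mor C W K" "k \<cdot> u = h"
    using kernelD(3)[OF ker f k] by blast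
  then show "h = Zero C W X"
    using zero_object_Mor(1)[OF zero] Comp_Zero[OF k] Mor_Obj by metis
qed

lemma monic_kernel_zero_object:
  assumes f: "f \<in> Mor C X Y" "monic C f" and ker: "is_kernel C f k" and k: "k \<in> Mor C K X"
  shows "zero_object C K"
proof -
  have K: "K \<in> Obj C"
    using k Mor_Obj by blast
  have "f \<cdot> k = Zero C K Y" and mk: "monic C k"
    using kernelD(1,2)[OF ker f(1) k] by auto
  then have "k = Zero C K X"
    using monic_cancel_Zero f k by blast
  then have "k \<cdot> Ident C K = Zero C K X"
    using Comp_Ident[OF k] by simp
  then have "Ident C K = Zero C K K"
    using monic_cancel_Zero[OF mk k Ident_Mor[OF K]] by blast
  then show ?thesis
    using zero_objectI K by blast
qed

end

section \<open>Length\<close>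

text \<open>The inductive form of \<open>finite_length\<close> remembers the number of factors and makes it possible to
  induct along a composition series.\<close>

inductive has_series :: "('o, 'm, 'z) cat_data_scheme \<Rightarrow> nat \<Rightarrow> 'o \<Rightarrow> bool" for C where
  zero: "zero_object C X \<Longrightarrow> has_series C 0 X"
| step: "\<lbrakk>has_series C n X; m \<in> Mor C X Y; monic C m; is_cokernel C m c; c \<in> Mor C Y S;
    simple_object C S\<rbrakk> \<Longrightarrow> has_series C (Suc n) Y"

text \<open>With the minimum over all composition series, one series of a subobject that is shorter than a
  minimal series of the whole object already shows that the length decreases.\<close>

definition len :: "('o, 'm, 'z) cat_data_scheme \<Rightarrow> 'o \<Rightarrow> nat" where
  "len C X = (LEAST n. has_series C n X)"

context abelian_category
begin

lemma has_series_isomorphic: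
  assumes "has_series C n X" "isomorphism C f" "f \<in> Mor C X Y"
  shows "has_series C n Y"
  using assms(1)
proof cases
  case zero
  then show ?thesis
    using has_series.zero[OF zero_object_isomorphic] assms by simp
next
  case (step n' X' m c S)
  have m: "m \<in> Mor C X' X" and c: "c \<in> Mor C X S"
    using step by auto
  have fm: "f \<cdot> m \<in> Mor C X' Y" "monic C (f \<cdot> m)"
    using Comp_Mor[OF m assms(3)] monic_Comp[OF m assms(3)] isomorphism_monic[OF assms(2)] step
    by auto
  obtain g where g: "g \<in> Mor C Y X" "g \<cdot> f = Ident C X" "f \<cdot> g = Ident C Y"
    using isomorphismE assms by metis
  have cg: "c \<cdot> g \<in> Mor C Y S"
    using Comp_Mor g c by blast
  have gfm: "g \<cdot> (f \<cdot> m) = m"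
    using Comp_assoc[OF m assms(3) g(1)] g(2) Ident_Comp[OF m] by simp
  have epi: "epic C c" and cm: "c \<cdot> m = Zero C X' S"
    and univ: "\<And>W h. \<lbrakk>h \<in> Mor C X W; h \<cdot> m = Zero C X' W\<rbrakk> \<Longrightarrow> \<exists>u \<in> Mor C S W. u \<cdot> c = h"
    using cokernelD[OF \<open>is_cokernel C m c\<close> m c] by auto
  have "is_cokernel C (f \<cdot> m) (c \<cdot> g)"
  proof (rule is_cokernelI[OF fm(1) cg])
    show "(c \<cdot> g) \<cdot> (f \<cdot> m) = Zero C X' S"
      using Comp_assoc[OF fm(1) g(1) c] gfm cm by simp
    show "epic C (c \<cdot> g)"
      using epic_Comp[OF g(1) c split_epi_epic[OF g(1) assms(3) g(2)] epi] .
    fix W h assume h: "h \<in> Mor C Y W" "h \<cdot> (f \<cdot> m) = Zero C X' W"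
    then have "(h \<cdot> f) \<cdot> m = Zero C X' W"
      using Comp_assoc[OF m assms(3) h(1)] by simp
    then obtain u where u: "u \<in> Mor C S W" "u \<cdot> c = h \<cdot> f"
      using univ Comp_Mor[OF assms(3) h(1)] by blast
    have "u \<cdot> (c \<cdot> g) = h"
      using Comp_assoc[OF g(1) c u(1)] Comp_assoc[OF g(1) assms(3) h(1)] u(2) g(3)
        Comp_Ident[OF h(1)] by simp
    with u show "\<exists>u \<in> Mor C S W. u \<cdot> (c \<cdot> g) = h" by blast
  qed
  then show ?thesis
    using has_series.step[OF _ fm _ cg] step by simp
qed

text \<open>A composition series of \<open>X\<close> is intersected with the subobject \<open>Y\<close>. With \<open>X'\<close> the last
  proper term and \<open>S = X / X'\<close>, the image of \<open>Y\<close> in the simple object \<open>S\<close> is zero or everything. In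
  the first case \<open>Y\<close> lies in \<open>X'\<close>, which saves the top factor. In the second case
  \<open>Y / (Y \<inter> X') = S\<close>, so a shorter series of \<open>Y \<inter> X'\<close> gives one of \<open>Y\<close>, while
  \<open>Y \<inter> X' = X'\<close> forces \<open>Y = X\<close>.\<close>

lemma subobject_has_shorter_series:
  assumes "has_series C n X" "y \<in> Mor C Y X" "monic C y"
  shows "isomorphism C y \<or> (\<exists>p<n. has_series C p Y)"
  using assms
proof (induction arbitrary: Y y rule: has_series.induct)
  case (zero X)
  have "Y \<in> Obj C" "X \<in> Obj C"
    using zero Mor_Obj by blast+
  then have z: "Zero C X Y \<in> Mor C X Y" "y \<cdot> Zero C X Y = Ident C X"
    using zero_object_Mor(1)[OF zero(1), of "Ident C X" X] Zero_Mor Ident_Mor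
      Comp_Zero[OF zero(2)] by auto
  then show ?case
    using split_epi_epic[OF zero(2)] monic_epic_isomorphism zero by blast
next
  case (step n X' x X c S)
  note x = \<open>x \<in> Mor C X' X\<close> and c = \<open>c \<in> Mor C X S\<close> and y = \<open>y \<in> Mor C Y X\<close>
  have obj: "Y \<in> Obj C" "S \<in> Obj C"
    using y c Mor_Obj by blast+
  have cy: "c \<cdot> y \<in> Mor C Y S"
    using Comp_Mor[OF y c] .
  have cx: "c \<cdot> x = Zero C X' S"
    and univ: "\<And>W h. \<lbrakk>h \<in> Mor C X W; h \<cdot> x = Zero C X' W\<rbrakk> \<Longrightarrow> \<exists>u \<in> Mor C S W. u \<cdot> c = h"
    using cokernelD[OF \<open>is_cokernel C x c\<close> x c] by auto
  note lift = monic_kernel_of_cokernel[OF \<open>monic C x\<close> x c \<open>is_cokernel C x c\<close>]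
  obtain J e s where es: "e \<in> Mor C Y J" "s \<in> Mor C J S" "epic C e" "monic C s" "c \<cdot> y = s \<cdot> e"
    using image_factorisation[OF cy] by metis
  have "zero_object C J \<or> isomorphism C s"
    using \<open>simple_object C S\<close> es by (auto simp: simple_object_def Mor_def)
  then show ?case
  proof
    assume "zero_object C J"
    then have "e = Zero C Y J"
      using zero_object_Mor es(1) by blast
    then have "c \<cdot> y = Zero C Y S"
      using es Comp_Zero[OF es(2) obj(1)] by simp
    then obtain y' where y': "y' \<in> Mor C Y X'" "x \<cdot> y' = y"
      using lift[OF y] by blast
    then have "monic C y'"
      using monic_Comp_right[OF y'(1) x] \<open>monic C y\<close> by simp
    then have "isomorphism C y' \<or> (\<exists>p<n. has_series C p Y)"
      using step.IH y' by blast
    then show ?thesis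
    proof
      assume "isomorphism C y'"
      then obtain g where g: "g \<in> Mor C X' Y" "g \<cdot> y' = Ident C Y" "y' \<cdot> g = Ident C X'"
        using isomorphismE y' by metis
      then have "has_series C n Y"
        using has_series_isomorphic[OF \<open>has_series C n X'\<close>] isomorphismI y' by blast
      then show ?thesis by blast
    qed (auto simp: less_Suc_eq)
  next
    assume "isomorphism C s"
    then have epi: "epic C (c \<cdot> y)"
      using epic_Comp[OF es(1,2,3)] isomorphism_epic es(5) by simp
    \<comment> \<open>\<open>K\<close> is the intersection \<open>Y \<inter> X'\<close>.\<close>
    obtain K k where k: "is_kernel C (c \<cdot> y) k" "k \<in> Mor C K Y" "(c \<cdot> y) \<cdot> k = Zero C K S" "monic C k"
      using ex_kernel_Mor[OF cy] by metis
    have cok: "is_cokernel C k (c \<cdot> y)"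
      using is_cokernelI[OF k(2) cy k(3) epi] epic_cokernel_of_kernel[OF epi cy k(2,1)] by blast
    have yk: "y \<cdot> k \<in> Mor C K X" "monic C (y \<cdot> k)"
      using Comp_Mor[OF k(2) y] monic_Comp[OF k(2) y k(4)] \<open>monic C y\<close> by auto
    have "c \<cdot> (y \<cdot> k) = Zero C K S"
      using Comp_assoc[OF k(2) y c] k(3) by simp
    then obtain k' where k': "k' \<in> Mor C K X'" "x \<cdot> k' = y \<cdot> k"
      using lift[OF yk(1)] by blast
    then have "monic C k'"
      using monic_Comp_right[OF k'(1) x] yk(2) by simp
    then have "isomorphism C k' \<or> (\<exists>p<n. has_series C p K)"
      using step.IH k' by blast
    then show ?thesis
    proof
      assume "isomorphism C k'"
      then obtain g where g: "g \<in> Mor C X' K" "k' \<cdot> g = Ident C X'"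
        using isomorphismE k' by metis
      have "x = x \<cdot> (k' \<cdot> g)"
        using g Comp_Ident[OF x] by simp
      also have "\<dots> = (y \<cdot> k) \<cdot> g"
        using Comp_assoc[OF g(1) k'(1) x] k'(2) by simp
      also have "\<dots> = y \<cdot> (k \<cdot> g)"
        using Comp_assoc[OF g(1) k(2) y] by simp
      finally have x_eq: "x = y \<cdot> (k \<cdot> g)" .
      have kg: "k \<cdot> g \<in> Mor C X' Y"
        using Comp_Mor g k by blast
      have "epic C y"
      proof (rule epicI[OF y])
        fix W h assume h: "h \<in> Mor C X W" "h \<cdot> y = Zero C Y W"
        have W: "W \<in> Obj C"
          using h Mor_Obj by blast
        have "h \<cdot> x = Zero C X' W"
          using x_eq Comp_assoc[OF kg y h(1)] h(2) Zero_Comp[OF kg W] by simp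
        then obtain u where u: "u \<in> Mor C S W" "u \<cdot> c = h"
          using univ h by blast
        then have "u \<cdot> (c \<cdot> y) = Zero C Y W"
          using Comp_assoc[OF y c u(1)] h(2) by simp
        then have "u = Zero C S W"
          using epic_cancel_Zero[OF epi cy u(1)] by blast
        then show "h = Zero C X W"
          using u(2) Zero_Comp[OF c W] by simp
      qed
      then show ?thesis
        using monic_epic_isomorphism y \<open>monic C y\<close> by blast
    next
      assume "\<exists>p<n. has_series C p K"
      then show ?thesis
        using has_series.step[OF _ k(2,4) cok cy \<open>simple_object C S\<close>] by auto
    qed
  qed
qed

end

context abelian_length_category
begin

lemma has_series_len:
  assumes X: "X \<in> Obj C"
  shows "has_series C (len C X) X"
proof -
  obtain n F m where series: "zero_object C (F 0) \<and> F n = X \<and>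
     (\<forall>k<n. m k \<in> Mor C (F k) (F (Suc k)) \<and> monic C (m k) \<and>
            (\<exists>c. is_cokernel C (m k) c \<and> simple_object C (Cod C c)))"
    using finite_length[OF X] unfolding finite_length_def by (elim exE) (rule that)
  then have F: "zero_object C (F 0)" "F n = X"
    and m: "\<And>k. k < n \<Longrightarrow> m k \<in> Mor C (F k) (F (Suc k)) \<and> monic C (m k) \<and>
      (\<exists>c. is_cokernel C (m k) c \<and> simple_object C (Cod C c))"
    by auto
  have "has_series C k (F k)" if "k \<le> n" for k
    using that
  proof (induction k)
    case 0
    show ?case
      using has_series.zero[OF F(1)] .
  next
    case (Suc k)
    have mk: "m k \<in> Mor C (F k) (F (Suc k))" "monic C (m k)"
      using m Suc by auto
    obtain c where c: "is_cokernel C (m k) c" "simple_object C (Cod C c)"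
      using m[of k] Suc by auto
    then have "c \<in> Mor C (F (Suc k)) (Cod C c)"
      using mk by (auto simp: is_cokernel_def Mor_def)
    then show ?case
      using Suc has_series.step[OF _ mk c(1) _ c(2)] by simp
  qed
  then have "has_series C n X"
    using F by auto
  then show ?thesis
    unfolding len_def by (rule LeastI)
qed

lemma len_proper_subobject:
  assumes "m \<in> Mor C Y X" "monic C m" "\<not> isomorphism C m"
  shows "len C Y < len C X"
proof -
  obtain p where "p < len C X" "has_series C p Y"
    using subobject_has_shorter_series[OF has_series_len] assms Mor_Obj by blast
  then show ?thesis
    unfolding len_def[of C Y] using Least_le[of "\<lambda>n. has_series C n Y" p] by simp
qed

lemma len_isomorphic:
  assumes "isomorphism C f" "f \<in> Mor C Y X"
  shows "len C Y = len C X"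
proof -
  obtain g where g: "g \<in> Mor C X Y" "g \<cdot> f = Ident C Y" "f \<cdot> g = Ident C X"
    using isomorphismE assms by metis
  then have iso: "isomorphism C g"
    using isomorphismI assms by blast
  have "has_series C n Y \<longleftrightarrow> has_series C n X" for n
    using has_series_isomorphic[OF _ assms] has_series_isomorphic[OF _ iso g(1)] by blast
  then show ?thesis
    by (simp add: len_def)
qed

lemma len_subobject: "\<lbrakk>m \<in> Mor C Y X; monic C m\<rbrakk> \<Longrightarrow> len C Y \<le> len C X"
  using len_proper_subobject[of m Y X] len_isomorphic[of m Y X] by force

lemma isomorphism_of_len_le:
  "\<lbrakk>m \<in> Mor C Y X; monic C m; len C X \<le> len C Y\<rbrakk> \<Longrightarrow> isomorphism C m"
  using len_proper_subobject[of m Y X] by force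

lemma len_zero_iff:
  assumes "X \<in> Obj C"
  shows "len C X = 0 \<longleftrightarrow> zero_object C X"
proof
  assume "len C X = 0"
  then have "has_series C 0 X"
    using has_series_len[OF assms] by simp
  then show "zero_object C X"
    by cases auto
next
  assume "zero_object C X"
  then show "len C X = 0"
    unfolding len_def using has_series.zero[of C X] by (simp add: Least_eq_0)
qed

end

section \<open>Minimal left approximations\<close>

context abelian_length_category
begin

text \<open>One half of Fitting's lemma, for \<open>g = m e\<close> with image \<open>J\<close>: if \<open>ker (g g) = ker g\<close>, then \<open>g\<close>
  restricts to an automorphism \<open>e m\<close> of \<open>J\<close>. Writing \<open>e m = m' e'\<close> with \<open>e'\<close> epic and \<open>m'\<close> monic,
  the epimorphisms \<open>e' e\<close> and \<open>e\<close> have the same kernel, hence are the same quotient of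
  \<open>X\<close>, so \<open>e'\<close> is monic; and a monic endomorphism of \<open>J\<close> is invertible because \<open>J\<close> has
  finite length.\<close>

lemma kernel_stable_endomorphism:
  assumes e: "e \<in> Mor C X J" "epic C e" and m: "m \<in> Mor C J X" "monic C m"
    and stable: "\<And>W h. \<lbrakk>h \<in> Mor C W X; (m \<cdot> e) \<cdot> ((m \<cdot> e) \<cdot> h) = Zero C W X\<rbrakk>
      \<Longrightarrow> (m \<cdot> e) \<cdot> h = Zero C W X"
  shows "isomorphism C (e \<cdot> m)"
proof -
  have em: "e \<cdot> m \<in> Mor C J J" and me: "m \<cdot> e \<in> Mor C X X"
    using Comp_Mor e m by blast+
  have J: "J \<in> Obj C" and X: "X \<in> Obj C"
    using Mor_Obj m by blast+
  obtain J' e' m' where e': "e' \<in> Mor C J J'" "epic C e'" and m': "m' \<in> Mor C J' J" "monic C m'"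
    and em_eq: "e \<cdot> m = m' \<cdot> e'"
    using image_factorisation[OF em] by metis
  have e'e: "e' \<cdot> e \<in> Mor C X J'" "epic C (e' \<cdot> e)"
    using Comp_Mor[OF e(1) e'(1)] epic_Comp[OF e(1) e'(1) e(2) e'(2)] by auto
  obtain K k where k: "is_kernel C (e' \<cdot> e) k" "k \<in> Mor C K X" "(e' \<cdot> e) \<cdot> k = Zero C K J'"
    using ex_kernel_Mor[OF e'e(1)] by metis
  have ek: "e \<cdot> k \<in> Mor C K J"
    using Comp_Mor[OF k(2) e(1)] .
  have K: "K \<in> Obj C"
    using Mor_Obj k by blast
  have "e' \<cdot> (e \<cdot> k) = Zero C K J'"
    using Comp_assoc[OF k(2) e(1) e'(1)] k(3) by simp
  then have "(e \<cdot> m) \<cdot> (e \<cdot> k) = Zero C K J"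
    using em_eq Comp_assoc[OF ek e'(1) m'(1)] Comp_Zero[OF m'(1) K] by simp
  then have "e \<cdot> (m \<cdot> (e \<cdot> k)) = Zero C K J"
    using Comp_assoc[OF ek m(1) e(1)] by simp
  moreover have mek: "(m \<cdot> e) \<cdot> k = m \<cdot> (e \<cdot> k)"
    using Comp_assoc[OF k(2) e(1) m(1)] by simp
  ultimately have "(m \<cdot> e) \<cdot> ((m \<cdot> e) \<cdot> k) = Zero C K X"
    using Comp_assoc[OF Comp_Mor[OF ek m(1)] e(1) m(1)] Comp_Zero[OF m(1) K] by simp
  then have "m \<cdot> (e \<cdot> k) = Zero C K X"
    using stable[OF k(2)] mek by simp
  then have "e \<cdot> k = Zero C K J"
    using monic_cancel_Zero[OF m(2,1) ek] by blast
  then obtain v where v: "v \<in> Mor C J' J" "v \<cdot> (e' \<cdot> e) = e"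
    using epic_cokernel_of_kernel[OF e'e(2,1) k(2,1) e(1)] by blast
  have "(v \<cdot> e') \<cdot> e = Ident C J \<cdot> e"
    using Comp_assoc[OF e(1) e'(1) v(1)] v(2) Ident_Comp[OF e(1)] by simp
  then have "v \<cdot> e' = Ident C J"
    using epicD[OF e(2,1)] Comp_Mor[OF e'(1) v(1)] Ident_Mor[OF J] by blast
  then have "monic C (e \<cdot> m)"
    using split_mono_monic[OF e'(1) v(1)] monic_Comp[OF e'(1) m'(1)] m'(2) em_eq by simp
  then show ?thesis
    using isomorphism_of_len_le[OF em] by simp
qed

lemma left_approximation_Cod: "\<lbrakk>left_approximation C \<X> Y a; a \<in> Mor C Y X\<rbrakk> \<Longrightarrow> X \<in> \<X>"
  by (auto simp: left_approximation_def Mor_def)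

lemma left_approximation_factor:
  "\<lbrakk>left_approximation C \<X> Y a; a \<in> Mor C Y X; X' \<in> \<X>; h \<in> Mor C Y X'\<rbrakk>
    \<Longrightarrow> \<exists>u \<in> Mor C X X'. h = u \<cdot> a"
  unfolding left_approximation_def by (auto simp: Mor_def)

text \<open>Two extremal choices replace the iteration of an endomorphism in Fitting's lemma: the target
  \<open>X\<close> has least length among all left approximations, and \<open>g\<close> has largest kernel among all \<open>g\<close>
  with \<open>g a = a\<close>. The set of these \<open>g\<close> is closed under composition, so the kernel of \<open>g g\<close> is not
  larger than that of \<open>g\<close>.\<close>

lemma ex_left_minimal_left_approximation:
  assumes add: "additive_subcategory C \<X>" and ex: "\<exists>a. left_approximation C \<X> Y a"
  obtains X a where "a \<in> Mor C Y X" "left_approximation C \<X> Y a" "left_minimal C a"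
proof -
  let ?P = "\<lambda>p. snd p \<in> Mor C Y (fst p) \<and> left_approximation C \<X> Y (snd p)"
  obtain X\<^sub>0 a\<^sub>0 where "a\<^sub>0 \<in> Mor C Y X\<^sub>0" "left_approximation C \<X> Y a\<^sub>0"
    using ex by (auto simp: left_approximation_def)
  then have "?P (X\<^sub>0, a\<^sub>0)" by simp
  from ex_has_least_nat[of ?P, OF this, of "\<lambda>p. len C (fst p)"]
  obtain p where p: "?P p \<and> (\<forall>p'. ?P p' \<longrightarrow> len C (fst p) \<le> len C (fst p'))"
    by (rule exE)
  obtain X a where "p = (X, a)"
    by (cases p)
  with p have a: "a \<in> Mor C Y X" "left_approximation C \<X> Y a"
    and least: "\<And>X' a'. \<lbrakk>a' \<in> Mor C Y X'; left_approximation C \<X> Y a'\<rbrakk> \<Longrightarrow> len C X \<le> len C X'"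
    by auto
  have X: "X \<in> Obj C" "X \<in> \<X>"
    using a Mor_Obj left_approximation_Cod by blast+
  let ?G = "\<lambda>p. fst p \<in> Mor C X X \<and> fst p \<cdot> a = a \<and> is_kernel C (fst p) (snd p)"
  have bounded: "len C (Dom C (snd p)) < Suc (len C X)" if "?G p" for p
    unfolding less_Suc_eq_le using that kernel_Mor[of "fst p" "snd p" X X] kernelD(2)[of "fst p" "snd p" X X] len_subobject
    by blast
  obtain K\<^sub>0 k\<^sub>0 where "is_kernel C (Ident C X) k\<^sub>0" "k\<^sub>0 \<in> Mor C K\<^sub>0 X"
    using ex_kernel_Mor[OF Ident_Mor[OF X(1)]] by metis
  then have "?G (Ident C X, k\<^sub>0)"
    using Ident_Mor[OF X(1)] Ident_Comp[OF a(1)] by simp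
  from ex_has_greatest_nat[of ?G, OF this, of "\<lambda>p. len C (Dom C (snd p))" "Suc (len C X)"] bounded
  obtain q where q: "?G q \<and> (\<forall>q'. ?G q' \<longrightarrow> len C (Dom C (snd q')) \<le> len C (Dom C (snd q)))"
    by blast
  obtain g k where "q = (g, k)"
    by (cases q)
  with q have g: "g \<in> Mor C X X" "g \<cdot> a = a" "is_kernel C g k"
    and greatest: "\<And>g' k'. \<lbrakk>g' \<in> Mor C X X; g' \<cdot> a = a; is_kernel C g' k'\<rbrakk>
      \<Longrightarrow> len C (Dom C k') \<le> len C (Dom C k)"
    by auto
  define K where "K = Dom C k"
  have k: "k \<in> Mor C K X" "g \<cdot> k = Zero C K X" "monic C k"
    using kernel_Mor[OF g(3,1)] kernelD(1,2)[OF g(3,1)] by (auto simp: K_def)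
  have K: "K \<in> Obj C"
    using k Mor_Obj by blast
  have gg: "g \<cdot> g \<in> Mor C X X" "(g \<cdot> g) \<cdot> a = a"
    using Comp_Mor[OF g(1) g(1)] Comp_assoc[OF a(1) g(1) g(1)] g(2) by auto
  have stable: "g \<cdot> h = Zero C W X" if h: "h \<in> Mor C W X" and "g \<cdot> (g \<cdot> h) = Zero C W X" for W h
  proof -
    obtain L l where l: "is_kernel C (g \<cdot> g) l" "l \<in> Mor C L X"
      and univ: "\<And>W h. \<lbrakk>h \<in> Mor C W X; (g \<cdot> g) \<cdot> h = Zero C W X\<rbrakk> \<Longrightarrow> \<exists>u \<in> Mor C W L. l \<cdot> u = h"
      using ex_kernel_Mor[OF gg(1)] by metis
    have "(g \<cdot> g) \<cdot> k = Zero C K X"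
      using Comp_assoc[OF k(1) g(1) g(1)] k(2) Comp_Zero[OF g(1) K] by simp
    then obtain u where u: "u \<in> Mor C K L" "l \<cdot> u = k"
      using univ[OF k(1)] by blast
    have "len C L \<le> len C K"
      using greatest[OF gg l(1)] l(2) by (auto simp: K_def Mor_def)
    then have "isomorphism C u"
      using isomorphism_of_len_le monic_Comp_right[OF u(1) l(2)] u k(3) by simp
    then obtain v where v: "v \<in> Mor C L K" "u \<cdot> v = Ident C L"
      using isomorphismE u(1) by metis
    have "k \<cdot> v = l"
      using Comp_assoc[OF v(1) u(1) l(2)] u(2) v(2) Comp_Ident[OF l(2)] by simp
    then have gl: "g \<cdot> l = Zero C L X"
      using Comp_assoc[OF v(1) k(1) g(1)] k(2) Zero_Comp[OF v(1) X(1)] by simp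
    have "(g \<cdot> g) \<cdot> h = Zero C W X"
      using that Comp_assoc[OF h g(1) g(1)] by simp
    then obtain w where w: "w \<in> Mor C W L" "l \<cdot> w = h"
      using univ[OF h] by blast
    then show ?thesis
      using Comp_assoc[OF w(1) l(2) g(1)] gl Zero_Comp[OF w(1) X(1)] by simp
  qed
  \<comment> \<open>The image \<open>J\<close> of \<open>g\<close> is a summand of \<open>X\<close>, and \<open>a\<close> restricts to an approximation with target
    \<open>J\<close>, so \<open>J\<close> is no shorter than \<open>X\<close>.\<close>
  obtain J e m where e: "e \<in> Mor C X J" "epic C e" and m: "m \<in> Mor C J X" "monic C m"
    and g_eq: "g = m \<cdot> e"
    using image_factorisation[OF g(1)] by metis
  have em: "e \<cdot> m \<in> Mor C J J"
    using Comp_Mor e m by blast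
  have iso: "isomorphism C (e \<cdot> m)"
    using kernel_stable_endomorphism[OF e m] stable g_eq by blast
  then obtain p where p: "p \<in> Mor C J J" "p \<cdot> (e \<cdot> m) = Ident C J"
    using isomorphismE em by metis
  have pe: "p \<cdot> e \<in> Mor C X J" "(p \<cdot> e) \<cdot> m = Ident C J"
    using Comp_Mor[OF e(1) p(1)] Comp_assoc[OF m(1) e(1) p(1)] p(2) by auto
  obtain j where "is_kernel C (p \<cdot> e) j"
    using ex_kernel_Mor[OF pe(1)] by metis
  from retract_direct_sum[OF m(1) pe this] obtain J' q' where "direct_sum C J J' X m j (p \<cdot> e) q'"
    by blast
  then have J: "J \<in> \<X>"
    using X(2) add unfolding additive_subcategory_def by metis
  have ea: "e \<cdot> a \<in> Mor C Y J"
    using Comp_Mor[OF a(1) e(1)] .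
  have mea: "m \<cdot> (e \<cdot> a) = a"
    using Comp_assoc[OF a(1) e(1) m(1)] g(2) g_eq by simp
  have "\<exists>u \<in> Mor C J X'. h = u \<cdot> (e \<cdot> a)" if "X' \<in> \<X>" "h \<in> Mor C Y X'" for X' h
  proof -
    obtain u where u: "u \<in> Mor C X X'" "h = u \<cdot> a"
      using left_approximation_factor[OF a(2,1)] \<open>X' \<in> \<X>\<close> \<open>h \<in> Mor C Y X'\<close> by blast
    then have "h = (u \<cdot> m) \<cdot> (e \<cdot> a)"
      using Comp_assoc[OF ea m(1) u(1)] mea by simp
    then show ?thesis
      using Comp_Mor[OF m(1) u(1)] by blast
  qed
  then have "left_approximation C \<X> Y (e \<cdot> a)"
    using J ea unfolding left_approximation_def by blast
  then have "isomorphism C m"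
    using isomorphism_of_len_le[OF m] least[OF ea] by blast
  then obtain n where n: "n \<in> Mor C X J" "m \<cdot> n = Ident C X"
    using isomorphismE m(1) by metis
  have "(e \<cdot> m) \<cdot> n = e"
    using Comp_assoc[OF n(1) m(1) e(1)] n(2) Comp_Ident[OF e(1)] by simp
  then have "monic C e"
    using monic_Comp[OF n(1) em split_mono_monic[OF n(1) m(1) n(2)] isomorphism_monic[OF iso]]
    by simp
  then have "monic C g"
    using monic_Comp[OF e(1) m(1)] m(2) g_eq by simp
  then have "len C K = 0"
    using monic_kernel_zero_object[OF g(1) _ g(3) k(1)] len_zero_iff[OF K] by simp
  \<comment> \<open>The largest kernel being zero, the property passes from \<open>g\<close> to all competitors \<open>g'\<close>.\<close>
  have "isomorphism C g'" if g': "g' \<in> Mor C X X" "g' \<cdot> a = a" for g'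
  proof -
    obtain K' k' where k': "is_kernel C g' k'" "k' \<in> Mor C K' X"
      using ex_kernel_Mor[OF g'(1)] by metis
    then have "len C K' = 0"
      using greatest[OF g' k'(1)] \<open>len C K = 0\<close> by (auto simp: K_def Mor_def)
    then have "zero_object C K'"
      using len_zero_iff Mor_Obj k'(2) by blast
    then have "monic C g'"
      using kernel_zero_object_monic[OF g'(1) k'] by blast
    then show ?thesis
      using isomorphism_of_len_le[OF g'(1)] by simp
  qed
  then have "left_minimal C a"
    using a(1) by (auto simp: left_minimal_def Mor_def)
  with that a show thesis by blast
qed

end

section \<open>The factorisation\<close>

lemma composite_of_Arr:
  assumes "small_category C" "composite_of C P g"
  shows "g \<in> Arr C"
  using assms(2)
proof induction
  case (comp f g)
  then show ?case
    using small_category.Comp_Mor[OF assms(1), of f "Dom C f" "Cod C f" g "Cod C g"]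
    by (auto simp: Mor_def)
qed

text \<open>Composites are built by adding arrows at the target end; the induction on images produces
  them starting from the source.\<close>

lemma composite_of_Comp:
  assumes C: "small_category C" and "composite_of C P g" and f: "f \<in> Arr C" "P f"
    and "Cod C f = Dom C g"
  shows "composite_of C P (g \<cdot>\<^bsub>C\<^esub> f)"
  using assms(2,5)
proof (induction rule: composite_of.induct)
  case (single g)
  then show ?case
    using composite_of.comp[OF composite_of.single] f by metis
next
  case (comp g h)
  have g: "g \<in> Mor C (Dom C g) (Cod C g)" and h: "h \<in> Mor C (Cod C g) (Cod C h)"
    using composite_of_Arr[OF C comp(1)] comp by (auto simp: Mor_def)
  have "h \<cdot>\<^bsub>C\<^esub> g \<in> Mor C (Dom C g) (Cod C h)"
    using small_category.Comp_Mor[OF C g h] .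
  with comp(6) have f': "f \<in> Mor C (Dom C f) (Dom C g)"
    using f by (auto simp: Mor_def)
  have "g \<cdot>\<^bsub>C\<^esub> f \<in> Mor C (Dom C f) (Cod C g)"
    using small_category.Comp_Mor[OF C f' g] .
  moreover have "composite_of C P (g \<cdot>\<^bsub>C\<^esub> f)"
    using comp.IH f' by (simp add: Mor_def)
  ultimately have "composite_of C P (h \<cdot>\<^bsub>C\<^esub> (g \<cdot>\<^bsub>C\<^esub> f))"
    using composite_of.comp[of C P "g \<cdot>\<^bsub>C\<^esub> f" h] comp by (simp add: Mor_def)
  then show ?case
    using small_category.Comp_assoc[OF C f' g h] by simp
qed

context abelian_length_category
begin

lemma epic_then_approximation_left_minimal:
  assumes e: "e \<in> Mor C X I" "epic C e" and a: "a \<in> Mor C I Z" "left_minimal C a"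
  shows "left_minimal C (a \<cdot> e)"
proof -
  have ae: "a \<cdot> e \<in> Mor C X Z"
    using Comp_Mor e a by blast
  have "isomorphism C g" if g: "g \<in> Mor C Z Z" "g \<cdot> (a \<cdot> e) = a \<cdot> e" for g
  proof -
    have "(g \<cdot> a) \<cdot> e = a \<cdot> e"
      using Comp_assoc[OF e(1) a(1) g(1)] g(2) by simp
    then have "g \<cdot> a = a"
      using epicD[OF e(2,1)] Comp_Mor[OF a(1) g(1)] a(1) by blast
    then show ?thesis
      using a g(1) by (auto simp: left_minimal_def Mor_def)
  qed
  then show ?thesis
    using ae by (auto simp: left_minimal_def Mor_def)
qed

text \<open>In the whole category \<open>e\<close> is the cokernel of its kernel \<open>K\<close>. To pass to the subcategory,
  \<open>K\<close> is covered by one of its objects, which changes no annihilation condition, and \<open>e\<close> is followed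
  by the approximation \<open>a\<close>, through which all morphisms from \<open>I\<close> into the subcategory factor.\<close>

lemma epic_then_approximation_weak_cokernel:
  assumes gen: "generating C \<X>" and X: "X \<in> \<X>" and e: "e \<in> Mor C X I" "epic C e"
    and a: "a \<in> Mor C I Z" "left_approximation C \<X> I a"
  shows "weak_cokernel C \<X> (a \<cdot> e)"
proof -
  obtain K k where k: "is_kernel C e k" "k \<in> Mor C K X" "e \<cdot> k = Zero C K I"
    using ex_kernel_Mor[OF e(1)] by metis
  have K: "K \<in> Obj C"
    using Mor_Obj k by blast
  then obtain P p where P: "P \<in> \<X>" and p: "p \<in> Mor C P K" "epic C p"
    using gen unfolding generating_def by blast
  have kp: "k \<cdot> p \<in> Mor C P X" and ae: "a \<cdot> e \<in> Mor C X Z"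
    using Comp_Mor k p e a by blast+
  have ekp: "e \<cdot> (k \<cdot> p) = Zero C P I"
    using Comp_assoc[OF p(1) k(2) e(1)] k(3) Zero_Comp[OF p(1)] Mor_Obj[OF e(1)] by simp
  have "(\<lambda>h. h \<cdot> (a \<cdot> e)) ` Mor C Z M = {h \<in> Mor C X M. h \<cdot> (k \<cdot> p) = Zero C P M}"
    if M: "M \<in> \<X>" for M
  proof (intro subset_antisym subsetI)
    fix h assume "h \<in> (\<lambda>h. h \<cdot> (a \<cdot> e)) ` Mor C Z M"
    then obtain u where u: "u \<in> Mor C Z M" and h: "h = u \<cdot> (a \<cdot> e)" by blast
    have "(a \<cdot> e) \<cdot> (k \<cdot> p) = Zero C P Z"
      using Comp_assoc[OF kp e(1) a(1)] ekp Comp_Zero[OF a(1)] Mor_Obj[OF kp] by simp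
    then have "h \<cdot> (k \<cdot> p) = Zero C P M"
      using Comp_assoc[OF kp ae u] h Comp_Zero[OF u] Mor_Obj[OF kp] by simp
    then show "h \<in> {h \<in> Mor C X M. h \<cdot> (k \<cdot> p) = Zero C P M}"
      using h Comp_Mor[OF ae u] by blast
  next
    fix h assume "h \<in> {h \<in> Mor C X M. h \<cdot> (k \<cdot> p) = Zero C P M}"
    then have h: "h \<in> Mor C X M" and "(h \<cdot> k) \<cdot> p = Zero C P M"
      using Comp_assoc[OF p(1) k(2)] by auto
    then have "h \<cdot> k = Zero C K M"
      using epic_cancel_Zero[OF p(2,1) Comp_Mor[OF k(2)]] by blast
    then obtain v where v: "v \<in> Mor C I M" "v \<cdot> e = h"
      using epic_cokernel_of_kernel[OF e(2,1) k(2,1) h] by blast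
    then obtain u where u: "u \<in> Mor C Z M" "v = u \<cdot> a"
      using left_approximation_factor[OF a(2,1) M] by blast
    then have "h = u \<cdot> (a \<cdot> e)"
      using Comp_assoc[OF e(1) a(1) u(1)] v(2) by simp
    with u show "h \<in> (\<lambda>h. h \<cdot> (a \<cdot> e)) ` Mor C Z M" by blast
  qed
  moreover have "Z \<in> \<X>"
    using left_approximation_Cod a by blast
  ultimately have "weak_cokernel_of C \<X> (k \<cdot> p) (a \<cdot> e)"
    using P X kp ae unfolding weak_cokernel_of_def by blast
  then show ?thesis
    unfolding weak_cokernel_def by blast
qed

text \<open>With \<open>p\<close> the inverse of \<open>q a\<close>, the endomorphism \<open>a p q\<close> fixes \<open>a\<close>, so left minimality makes
  it invertible and its right factor \<open>q\<close> monic. This is what ends the induction when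
  the image stops growing.\<close>

lemma monic_of_left_minimal_retract:
  assumes a: "a \<in> Mor C I X" "left_minimal C a" and q: "q \<in> Mor C X I'"
    and iso: "isomorphism C (q \<cdot> a)"
  shows "monic C q"
proof -
  have qa: "q \<cdot> a \<in> Mor C I I'"
    using Comp_Mor a q by blast
  obtain p where p: "p \<in> Mor C I' I" "p \<cdot> (q \<cdot> a) = Ident C I"
    using isomorphismE[OF iso qa] by metis
  have g: "(a \<cdot> p) \<cdot> q \<in> Mor C X X" and ap: "a \<cdot> p \<in> Mor C I' X"
    using Comp_Mor a p q by blast+
  have "((a \<cdot> p) \<cdot> q) \<cdot> a = (a \<cdot> p) \<cdot> (q \<cdot> a)"
    using Comp_assoc[OF a(1) q ap] by simp
  also have "\<dots> = a \<cdot> (p \<cdot> (q \<cdot> a))"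
    using Comp_assoc[OF qa p(1) a(1)] by simp
  also have "\<dots> = a"
    using p(2) Comp_Ident[OF a(1)] by simp
  finally have "isomorphism C ((a \<cdot> p) \<cdot> q)"
    using a g by (auto simp: left_minimal_def Mor_def)
  then show ?thesis
    using isomorphism_monic monic_Comp_right[OF q ap] by blast
qed

text \<open>The induction is on the codimension \<open>len N - len I\<close> of the image \<open>I\<close> of the morphism. The step
  embeds \<open>I\<close> into the image \<open>I'\<close> of the remaining factor by \<open>e' a\<close>; either this embedding is
  an isomorphism and the remaining factor is monic, or the codimension drops.\<close>

lemma factorisation_through_weak_cokernels:
  assumes add: "additive_subcategory C \<X>" and fin: "functorially_finite C \<X>"
    and gen: "generating C \<X>" and N: "N \<in> \<X>"
    and "M \<in> \<X>" "f \<in> Mor C M N"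
  shows "\<exists>L \<in> \<X>. \<exists>f\<^sub>1 \<in> Mor C M L. \<exists>f\<^sub>2 \<in> Mor C L N. f = f\<^sub>2 \<cdot> f\<^sub>1 \<and> monic C f\<^sub>2 \<and>
    composite_of C (\<lambda>g. left_minimal C g \<and> weak_cokernel C \<X> g) f\<^sub>1"
proof -
  let ?P = "\<lambda>g. left_minimal C g \<and> weak_cokernel C \<X> g"
  have *: "\<exists>L \<in> \<X>. \<exists>f\<^sub>1 \<in> Mor C M L. \<exists>f\<^sub>2 \<in> Mor C L N. m \<cdot> e = f\<^sub>2 \<cdot> f\<^sub>1 \<and> monic C f\<^sub>2 \<and>
      composite_of C ?P f\<^sub>1"
    if "M \<in> \<X>" "e \<in> Mor C M I" "epic C e" "m \<in> Mor C I N" "monic C m" for M I e m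
    using that
  proof (induction "len C N - len C I" arbitrary: M I e m rule: less_induct)
    case less
    note e = \<open>e \<in> Mor C M I\<close> and m = \<open>m \<in> Mor C I N\<close>
    have "\<exists>a. left_approximation C \<X> I a"
      using fin Mor_Obj(2)[OF e] unfolding functorially_finite_def by blast
    then obtain X a where a: "a \<in> Mor C I X" "left_approximation C \<X> I a" "left_minimal C a"
      using ex_left_minimal_left_approximation[OF add] by metis
    have X: "X \<in> \<X>"
      using left_approximation_Cod a by blast
    obtain f' where f': "f' \<in> Mor C X N" "m = f' \<cdot> a"
      using left_approximation_factor[OF a(2,1) N m] by blast
    have ae: "a \<cdot> e \<in> Mor C M X"
      using Comp_Mor[OF e a(1)] .
    have P: "?P (a \<cdot> e)"
      using epic_then_approximation_left_minimal[OF e _ a(1,3)]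
        epic_then_approximation_weak_cokernel[OF gen _ e _ a(1,2)] less.prems by blast
    have f_eq: "m \<cdot> e = f' \<cdot> (a \<cdot> e)"
      using Comp_assoc[OF e a(1) f'(1)] f'(2) by simp
    obtain I' e' m' where e': "e' \<in> Mor C X I'" "epic C e'"
      and m': "m' \<in> Mor C I' N" "monic C m'" and f'_eq: "f' = m' \<cdot> e'"
      using image_factorisation[OF f'(1)] by metis
    have e'a: "e' \<cdot> a \<in> Mor C I I'"
      using Comp_Mor[OF a(1) e'(1)] .
    have "m' \<cdot> (e' \<cdot> a) = m"
      using Comp_assoc[OF a(1) e'(1) m'(1)] f'(2) f'_eq by simp
    then have mono: "monic C (e' \<cdot> a)"
      using monic_Comp_right[OF e'a m'(1)] \<open>monic C m\<close> by simp
    show ?case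
    proof (cases "isomorphism C (e' \<cdot> a)")
      case True
      then have "monic C e'"
        using monic_of_left_minimal_retract[OF a(1,3) e'(1)] by blast
      then have "monic C f'"
        using monic_Comp[OF e'(1) m'(1)] m'(2) f'_eq by simp
      moreover have "composite_of C ?P (a \<cdot> e)"
        using composite_of.single[of "a \<cdot> e" C ?P] P ae by (simp add: Mor_def)
      ultimately show ?thesis
        using X ae f'(1) f_eq by blast
    next
      case False
      then have "len C I < len C I'"
        using len_proper_subobject[OF e'a mono] by blast
      moreover have "len C I' \<le> len C N"
        using len_subobject m' by blast
      ultimately have "len C N - len C I' < len C N - len C I" by simp
      from less.hyps[OF this X e' m'] obtain L f\<^sub>1 f\<^sub>2
        where L: "L \<in> \<X>" "f\<^sub>1 \<in> Mor C X L" "f\<^sub>2 \<in> Mor C L N" "f' = f\<^sub>2 \<cdot> f\<^sub>1" "monic C f\<^sub>2"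
          "composite_of C ?P f\<^sub>1"
        using f'_eq by blast
      have "m \<cdot> e = f\<^sub>2 \<cdot> (f\<^sub>1 \<cdot> (a \<cdot> e))"
        using f_eq L(4) Comp_assoc[OF ae L(2,3)] by simp
      moreover have "f\<^sub>1 \<cdot> (a \<cdot> e) \<in> Mor C M L"
        using Comp_Mor[OF ae L(2)] .
      moreover have "composite_of C ?P (f\<^sub>1 \<cdot> (a \<cdot> e))"
        using composite_of_Comp[OF small_category_axioms L(6), of "a \<cdot> e"] P ae L(2)
        by (simp add: Mor_def)
      ultimately show ?thesis
        using L by blast
    qed
  qed
  obtain I e m where "e \<in> Mor C M I" "m \<in> Mor C I N" "epic C e" "monic C m" "f = m \<cdot> e"
    using image_factorisation[OF \<open>f \<in> Mor C M N\<close>] by metis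
  then show ?thesis
    using *[OF \<open>M \<in> \<X>\<close>, of e I m] by simp
qed

end

theorem proposition3p13:
  fixes \<A> :: "('o, 'm) cat_data" and \<M> :: "'o set" and d :: nat and M N :: 'o and f :: 'm
  assumes "abelian_length_category \<A>"
    and "d \<ge> 1"
    and "cluster_tilting \<A> d \<M>"
    and "M \<in> \<M>" and "N \<in> \<M>" and "f \<in> Mor \<A> M N"
  shows "\<exists>L \<in> \<M>. \<exists>f\<^sub>1 \<in> Mor \<A> M L. \<exists>f\<^sub>2 \<in> Mor \<A> L N.
           f = f\<^sub>2 \<cdot>\<^bsub>\<A>\<^esub> f\<^sub>1 \<and>
           monic \<A> f\<^sub>2 \<and>
           composite_of \<A> (\<lambda>g. left_minimal \<A> g \<and> weak_cokernel \<A> \<M> g) f\<^sub>1"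
proof (rule abelian_length_category.factorisation_through_weak_cokernels[OF assms(1)])
  show "additive_subcategory \<A> \<M>" "functorially_finite \<A> \<M>" "generating \<A> \<M>"
    using assms(3) unfolding cluster_tilting_def by auto
qed (use assms in auto)

end
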